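(* There exists $n_0$ such that for every $n\geq n_0$ and every proper edge-colouring of the complete graph $K_n$, there are two vertex-disjoint rainbow cycles $C_1,C_2\subseteq K_n$ with $V(C_1)\cup V(C_2)=V(K_n)$.
   Context: A proper edge-colouring of a graph $G$ is a colouring of $E(G)$ (with any number of colours) in which edges of the same colour do not share vertices. A subgraph $H\subseteq G$ is rainbow if the colours of the edges of $H$ are all distinct. The two cycles are each required to be rainbow individually; they are allowed to share colours with each other. A cycle is a cycle in the usual graph-theoretic sense (on at least 3 vertices). *)

theory Defs imports Main
begin

text \<open>Finite simple graphs are pairs (vertex set, edge set), where an edge is a two-element
  set of vertices.\<close>

type_synonym 'a graph = "'a set \<times> 'a set set"

abbreviation verts :: "'a graph \<Rightarrow> 'a set" where
  "verts G \<equiv> fst G"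

abbreviation edges :: "'a graph \<Rightarrow> 'a set set" where
  "edges G \<equiv> snd G"

definition complete_graph :: "nat \<Rightarrow> nat graph" where
  "complete_graph n = ({..<n}, {{u, v} |u v. u < n \<and> v < n \<and> u \<noteq> v})"

definition subgraph :: "'a graph \<Rightarrow> 'a graph \<Rightarrow> bool" where
  "subgraph H G \<longleftrightarrow> verts H \<subseteq> verts G \<and> edges H \<subseteq> edges G"

text \<open>Colours are drawn from an arbitrary type; values of \<open>c\<close> outside \<open>edges G\<close> are irrelevant.\<close>

definition proper_edge_colouring :: "'a graph \<Rightarrow> ('a set \<Rightarrow> 'c) \<Rightarrow> bool" where
  "proper_edge_colouring G c \<longleftrightarrow>
     (\<forall>e\<in>edges G. \<forall>f\<in>edges G. e \<noteq> f \<and> c e = c f \<longrightarrow> e \<inter> f = {})"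

definition rainbow :: "('a set \<Rightarrow> 'c) \<Rightarrow> 'a graph \<Rightarrow> bool" where
  "rainbow c H \<longleftrightarrow> inj_on c (edges H)"

text \<open>\<open>vs\<close> lists the vertices of the cycle in cyclic order, so the closing edge joins the last
  entry to the first.\<close>

definition is_cycle :: "'a graph \<Rightarrow> bool" where
  "is_cycle C \<longleftrightarrow>
     (\<exists>vs. distinct vs \<and> length vs \<ge> 3 \<and> verts C = set vs \<and>
        edges C = {{vs ! i, vs ! (Suc i mod length vs)} |i. i < length vs})"

end

theory Submission imports Defs "HOL-Real_Asymp.Real_Asymp"
begin

text \<open>
  Fix a set \<open>R\<close> of \<open>\<delta>n\<close> vertices inside which few pairs of edges share a colour; an average set of this
  size has at most \<open>\<delta>\<^sup>4n\<^sup>3\<close> such pairs, and one is found by deleting vertices greedily. Reserve a sparse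
  set \<open>K\<close> of colours such that any two vertices have many common neighbours in \<open>R\<close> joined to both by
  \<open>K\<close>-coloured edges. Outside \<open>R\<close>, a rotation argument gives a rainbow linear forest avoiding \<open>K\<close> that has
  only a bounded number of paths and misses only few vertices. Linking its paths through \<open>R\<close> by colours of
  \<open>K\<close> yields the first cycle. The set \<open>L\<close> of remaining vertices is \<open>R\<close> up to a small error, so any \<open>|L|\<close>
  colours together cover only a small fraction of the edges inside \<open>L\<close>. With so many spare
  colours, a longest rainbow cycle in \<open>L\<close> can be extended by inserting a vertex and repairing the at
  most two repeated colours, hence it is Hamiltonian in \<open>L\<close>; it is the second cycle.\<close>

text \<open>For even n a proper colouring may use only n - 1 colours, fewer than a Hamiltonian cycle
  has edges, so one rainbow cycle cannot always suffice. Two cycles may share colours: the first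
  gains slack by leaving out a small linear share of the vertices, the second by living on few
  vertices and being free to use every colour. The obstacle is that the first cycle decides which
  vertices are left, and these must then be covered exactly. So all that the second cycle needs is a
  property of \<open>R\<close> that survives small changes: a bound, for every set of at most
  \<open>card L\<close> colours, on the pairs that it colours. Linking uses at most one vertex of
  \<open>R\<close> and two reserved colours per path, so a number \<open>r\<close> of paths
  independent of n makes its cost constant. No probability is used: \<open>R\<close> comes from
  averaging over deletions, \<open>K\<close> from rounding a multi-affine function. Scale:
  \<open>s\<close> is about n/10^12. At most T + n/r vertices stay uncovered, where \<open>T\<close>
  bounds the degrees in reserved colours; \<open>T = s div 2\<close> and r = 4*10^12 make this at
  most \<open>s\<close>. The density \<eta> = 10^-13 keeps these degrees below \<open>T\<close>, and
  \<open>card R = 9010 * s\<close> makes \<open>s\<close> negligible inside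
  \<open>R\<close>.\<close>

subsection \<open>Paths and linear forests\<close>

fun path_edges :: "'a list \<Rightarrow> 'a set set" where
  "path_edges (x # y # zs) = insert {x, y} (path_edges (y # zs))"
| "path_edges _ = {}"

lemma path_edges_append:
  "xs \<noteq> [] \<Longrightarrow> ys \<noteq> [] \<Longrightarrow>
    path_edges (xs @ ys) = insert {last xs, hd ys} (path_edges xs \<union> path_edges ys)"
proof (induction xs rule: path_edges.induct)
  case ("2_2" v)
  then show ?case by (cases ys) auto
qed auto

lemma path_edges_rev: "path_edges (rev xs) = path_edges xs"
proof (induction xs)
  case (Cons x xs)
  show ?case
  proof (cases xs)
    case (Cons y ys)
    have "path_edges (rev xs @ [x]) = insert {last (rev xs), x} (path_edges (rev xs))"
      using Cons by (subst path_edges_append) auto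
    then show ?thesis using Cons Cons.IH by (auto simp: last_rev insert_commute)
  qed simp
qed simp

lemma path_edges_subset: "e \<in> path_edges xs \<Longrightarrow> e \<subseteq> set xs"
  by (induction xs rule: path_edges.induct) auto

lemma path_edges_split:
  "e \<in> path_edges xs \<Longrightarrow> \<exists>us vs. xs = us @ vs \<and> us \<noteq> [] \<and> vs \<noteq> [] \<and> e = {last us, hd vs}"
proof (induction xs rule: path_edges.induct)
  case (1 x y zs)
  then consider "e = {x, y}" | "e \<in> path_edges (y # zs)" by auto
  then show ?case
  proof cases
    case 1
    then show ?thesis by (intro exI[of _ "[x]"] exI[of _ "y # zs"]) auto
  next
    case 2
    then obtain us vs where "y # zs = us @ vs" "us \<noteq> []" "vs \<noteq> []" "e = {last us, hd vs}"
      using "1.IH" by blast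
    then show ?thesis by (intro exI[of _ "x # us"] exI[of _ vs]) auto
  qed
qed auto

lemma finite_path_edges: "finite (path_edges xs)"
  by (induction xs rule: path_edges.induct) auto

lemma card_path_edges_le: "card (path_edges xs) \<le> length xs - 1"
proof (induction xs rule: path_edges.induct)
  case (1 x y zs)
  then show ?case using card_insert_le_m1[of "length (y#zs)" "path_edges (y#zs)" "{x,y}"] by simp
qed auto

text \<open>Paths are indexed, oriented vertex lists, because rotations treat them in turn and
  depend on orientation. One-vertex paths are allowed; values at indices from \<open>r\<close> on
  are irrelevant.\<close>

definition linear_forest :: "nat \<Rightarrow> (nat \<Rightarrow> 'a list) \<Rightarrow> bool" where
  "linear_forest r P \<longleftrightarrow> (\<forall>l<r. P l \<noteq> [] \<and> distinct (P l)) \<and>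
     (\<forall>l<r. \<forall>l'<r. l \<noteq> l' \<longrightarrow> set (P l) \<inter> set (P l') = {})"

definition forest_verts :: "nat \<Rightarrow> (nat \<Rightarrow> 'a list) \<Rightarrow> 'a set" where
  "forest_verts r P = (\<Union>l<r. set (P l))"

definition forest_edges :: "nat \<Rightarrow> (nat \<Rightarrow> 'a list) \<Rightarrow> 'a set set" where
  "forest_edges r P = (\<Union>l<r. path_edges (P l))"

lemma finite_forest_verts [simp]: "finite (forest_verts r P)"
  by (auto simp: forest_verts_def)

lemma finite_forest_edges [simp]: "finite (forest_edges r P)"
  by (auto simp: forest_edges_def finite_path_edges)

lemma linear_forestD:
  assumes "linear_forest r P" "l < r"
  shows "P l \<noteq> []" "distinct (P l)" "l' < r \<Longrightarrow> l \<noteq> l' \<Longrightarrow> set (P l) \<inter> set (P l') = {}"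
  using assms by (auto simp: linear_forest_def)

lemma card_forest_verts:
  assumes "linear_forest r P"
  shows "card (forest_verts r P) = (\<Sum>l<r. length (P l))"
proof -
  have "card (forest_verts r P) = (\<Sum>l<r. card (set (P l)))"
    unfolding forest_verts_def
    by (intro card_UN_disjoint) (use assms in \<open>auto simp: linear_forest_def\<close>)
  also have "\<dots> = (\<Sum>l<r. length (P l))"
    using linear_forestD(2)[OF assms] by (intro sum.cong) (auto simp: distinct_card)
  finally show ?thesis .
qed

lemma card_forest_edges_le:
  assumes "linear_forest r P"
  shows "card (forest_edges r P) + r \<le> card (forest_verts r P)"
proof -
  have "card (forest_edges r P) \<le> (\<Sum>l<r. card (path_edges (P l)))"
    unfolding forest_edges_def by (intro card_UN_le) auto
  also have "\<dots> \<le> (\<Sum>l<r. length (P l) - 1)" by (intro sum_mono card_path_edges_le)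
  finally have "card (forest_edges r P) + r \<le> (\<Sum>l<r. length (P l) - 1) + (\<Sum>l<r. 1)" by simp
  also have "\<dots> = (\<Sum>l<r. length (P l) - 1 + 1)" by (simp only: sum.distrib)
  also have "\<dots> = (\<Sum>l<r. length (P l))"
    using linear_forestD(1)[OF assms]
    by (intro sum.cong) (auto simp: Suc_le_eq simp flip: length_greater_0_conv)
  finally show ?thesis using card_forest_verts[OF assms] by simp
qed

lemma linear_forest_update2:
  assumes lf: "linear_forest r P" and ij: "i < r" "b < r" "i \<noteq> b"
    and ne: "xs \<noteq> []" "ys \<noteq> []" "distinct xs" "distinct ys" "set xs \<inter> set ys = {}"
    and st: "set xs \<union> set ys = set (P i) \<union> set (P b)"
  shows "linear_forest r (P(i := xs, b := ys))"
    "forest_verts r (P(i := xs, b := ys)) = forest_verts r P"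
proof -
  have d: "l < r \<Longrightarrow> l \<noteq> i \<Longrightarrow> l \<noteq> b \<Longrightarrow> set (P l) \<inter> (set xs \<union> set ys) = {}" for l
    unfolding st using lf ij by (auto simp: linear_forest_def)
  show "linear_forest r (P(i := xs, b := ys))"
    using lf ne d ij unfolding linear_forest_def by (auto simp: Int_commute)
  have "{..<r} = insert i (insert b ({..<r} - {i, b}))" using ij by auto
  then have U: "(\<Union>l<r. f l) = f i \<union> f b \<union> (\<Union>l\<in>{..<r} - {i, b}. f l)" for f :: "nat \<Rightarrow> 'a set"
    by (metis Un_assoc UN_insert)
  show "forest_verts r (P(i := xs, b := ys)) = forest_verts r P"
    unfolding forest_verts_def U[of "\<lambda>l. set (P l)"] U[of "\<lambda>l. set ((P(i := xs, b := ys)) l)"]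
    using st ij by auto
qed

lemma forest_edges_update2:
  assumes "i < r" "b < r" "i \<noteq> b"
  shows "forest_edges r (P(i := xs, b := ys)) =
    path_edges xs \<union> path_edges ys \<union> (\<Union>l\<in>{..<r} - {i, b}. path_edges (P l))"
proof -
  have "{..<r} = insert i (insert b ({..<r} - {i, b}))" using assms by auto
  then have U: "(\<Union>l<r. f l) = f i \<union> f b \<union> (\<Union>l\<in>{..<r} - {i, b}. f l)" for f :: "nat \<Rightarrow> 'a set set"
    by (metis Un_assoc UN_insert)
  show ?thesis unfolding forest_edges_def U[of "\<lambda>l. path_edges ((P(i := xs, b := ys)) l)"]
    using assms by auto
qed

lemma linear_forest_update:
  assumes lf: "linear_forest r P" and i: "i < r"
    and xs: "xs \<noteq> []" "distinct xs" "set xs = S \<union> set (P i)" and S: "S \<inter> forest_verts r P = {}"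
  shows "linear_forest r (P(i := xs))" "forest_verts r (P(i := xs)) = S \<union> forest_verts r P"
proof -
  have d: "l < r \<Longrightarrow> l \<noteq> i \<Longrightarrow> set (P l) \<inter> set xs = {}" for l
    unfolding xs(3) using linear_forestD(3)[OF lf _ i, of l] S by (auto simp: forest_verts_def)
  show "linear_forest r (P(i := xs))"
    using lf xs(1,2) d i unfolding linear_forest_def by (auto simp: Int_commute)
  have "{..<r} = insert i ({..<r} - {i})" using i by auto
  then have U: "(\<Union>l<r. f l) = f i \<union> (\<Union>l\<in>{..<r} - {i}. f l)" for f :: "nat \<Rightarrow> 'a set"
    by (metis UN_insert)
  show "forest_verts r (P(i := xs)) = S \<union> forest_verts r P"
    unfolding forest_verts_def U[of "\<lambda>l. set (P l)"] U[of "\<lambda>l. set ((P(i := xs)) l)"]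
    using xs by auto
qed

lemma forest_edges_update:
  assumes "i < r"
  shows "forest_edges r (P(i := xs)) = path_edges xs \<union> (\<Union>l\<in>{..<r} - {i}. path_edges (P l))"
proof -
  have "{..<r} = insert i ({..<r} - {i})" using assms by auto
  then have U: "(\<Union>l<r. f l) = f i \<union> (\<Union>l\<in>{..<r} - {i}. f l)" for f :: "nat \<Rightarrow> 'a set set"
    by (metis UN_insert)
  show ?thesis unfolding forest_edges_def U[of "\<lambda>l. path_edges ((P(i := xs)) l)"]
    by auto
qed

text \<open>A Posa rotation with several paths: the edge from \<open>p\<close> to \<open>y\<close>
  is traded for one from the start \<open>s\<close> of path \<open>i\<close> to \<open>y\<close>. If
  \<open>y\<close> lies on path \<open>i\<close>, the part before \<open>y\<close> is reversed;
  otherwise path \<open>i\<close> is glued to the piece of the other path that ends in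
  \<open>y\<close>, and the remaining piece stays as a path. Later paths can only lose a final
  piece, which is the last conclusion.\<close>

lemma rotate_forest:
  assumes lf: "linear_forest r P" and i: "i < r"
    and py: "{p, y} \<in> forest_edges r P" "p \<noteq> y"
    and s: "s = hd (P i)" "{s, y} \<notin> forest_edges r P"
    and ord: "\<And>l us vs. i \<le> l \<Longrightarrow> l < r \<Longrightarrow> P l \<noteq> us @ y # p # vs"
  obtains P' where "linear_forest r P'" "forest_verts r P' = forest_verts r P"
    "forest_edges r P' \<subseteq> insert {s, y} (forest_edges r P - {{p, y}})"
    "forest_edges r P - {{p, y}} \<subseteq> forest_edges r P'"
    "\<And>l. i < l \<Longrightarrow> l < r \<Longrightarrow> \<exists>t. P l = P' l @ t"
proof -
  note lfD = linear_forestD[OF lf]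
  obtain b where b: "b < r" "{p, y} \<in> path_edges (P b)" using py by (auto simp: forest_edges_def)
  obtain us vs where uv: "P b = us @ vs" "us \<noteq> []" "vs \<noteq> []" "{p, y} = {last us, hd vs}"
    using path_edges_split[OF b(2)] by blast
  have nin: "{p, y} \<notin> path_edges (P l)" if "l < r" "l \<noteq> b" for l
    using path_edges_subset[of "{p,y}" "P l"] path_edges_subset[OF b(2)] lfD(3)[of l b] that b by auto
  have dis: "distinct us" "distinct vs" "set us \<inter> set vs = {}"
    using lfD(2)[OF b(1)] uv by auto
  have lh: "last us \<in> set us" "hd vs \<in> set vs" using uv by auto
  have nus: "{p, y} \<notin> path_edges us" "{p, y} \<notin> path_edges vs"
    using path_edges_subset[of "{p,y}" us] path_edges_subset[of "{p,y}" vs] uv(4) lh dis by auto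
  have syp: "{s, y} \<noteq> {p, y}" using py s by auto
  have U1: "forest_edges r P = path_edges (P b) \<union> (\<Union>l\<in>{..<r} - {b}. path_edges (P l))"
    using forest_edges_update[OF b(1), of P "P b"] by simp
  have Pb: "path_edges (P b) = insert {p, y} (path_edges us \<union> path_edges vs)"
    unfolding uv(1) uv(4) using uv by (intro path_edges_append)
  show thesis
  proof (cases "b = i")
    case True
    \<comment> \<open>If \<open>y\<close> preceded \<open>p\<close> on path \<open>i\<close>, the
      new edge would close the segment from \<open>s\<close> to \<open>y\<close> to a cycle;
      \<open>ord\<close> excludes this.\<close>
    have *: "last us = p \<and> hd vs = y"
    proof (rule ccontr)
      assume "\<not> ?thesis"
      then have "last us = y" "hd vs = p" using uv(4) by (auto simp: doubleton_eq_iff)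
      then have "P b = butlast us @ y # p # tl vs" using uv
        by (metis append_Cons append_Nil append_assoc append_butlast_last_id list.collapse)
      then show False using ord[of b "butlast us" "tl vs"] True b by simp
    qed
    let ?P = "P(i := rev us @ vs)"
    have e: "path_edges (rev us @ vs) = insert {s, y} (path_edges us \<union> path_edges vs)"
      using path_edges_append[of "rev us" vs] uv * True s
      by (simp add: path_edges_rev last_rev)
    show thesis
    proof (rule that[of ?P])
      show "linear_forest r ?P" "forest_verts r ?P = forest_verts r P"
        using linear_forest_update[OF lf i, of "rev us @ vs" "{}"] uv True dis by auto
      show "forest_edges r ?P \<subseteq> insert {s, y} (forest_edges r P - {{p, y}})"
        unfolding forest_edges_update[OF i] e U1 Pb using True nin nus by auto
      show "forest_edges r P - {{p, y}} \<subseteq> forest_edges r ?P"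
        unfolding forest_edges_update[OF i] e U1 Pb using True by auto
    qed auto
  next
    case False
    have dbi: "set (P b) \<inter> set (P i) = {}" using lfD(3)[OF b(1) i] False by auto
    have Pi: "P i \<noteq> []" "distinct (P i)" using lfD i by auto
    have U2: "forest_edges r P = path_edges (P i) \<union> path_edges (P b) \<union>
        (\<Union>l\<in>{..<r} - {i, b}. path_edges (P l))"
      using forest_edges_update2[OF i b(1), of P "P i" "P b"] False by simp
    show thesis
    proof (cases "last us = p")
      case True
      then have y: "hd vs = y" using uv(4) by (auto simp: doubleton_eq_iff)
      let ?P = "P(i := rev (P i) @ vs, b := us)"
      have e: "path_edges (rev (P i) @ vs) = insert {s, y} (path_edges (P i) \<union> path_edges vs)"
        using path_edges_append[of "rev (P i)" vs] uv y s Pi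
        by (simp add: path_edges_rev last_rev)
      show thesis
      proof (rule that[of ?P])
        show "linear_forest r ?P" "forest_verts r ?P = forest_verts r P"
          using linear_forest_update2[OF lf i b(1) not_sym[OF False], of "rev (P i) @ vs" us]
            uv dis dbi Pi by auto
        show "forest_edges r ?P \<subseteq> insert {s, y} (forest_edges r P - {{p, y}})"
          unfolding forest_edges_update2[OF i b(1) not_sym[OF False]] e U2 Pb
          using nin nus i False by auto
        show "forest_edges r P - {{p, y}} \<subseteq> forest_edges r ?P"
          unfolding forest_edges_update2[OF i b(1) not_sym[OF False]] e U2 Pb by auto
        show "\<exists>t. P l = ?P l @ t" if "i < l" "l < r" for l using that uv by auto
      qed
    next
      case f: False
      then have y: "last us = y" "hd vs = p" using uv(4) by (auto simp: doubleton_eq_iff)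
      then have "P b = butlast us @ y # p # tl vs" using uv
        by (metis append_Cons append_Nil append_assoc append_butlast_last_id list.collapse)
      \<comment> \<open>The reversed orientation can occur only on a path before \<open>i\<close>,
        for which nothing about prefixes has to be preserved.\<close>
      then have bi: "b < i" using ord[of b "butlast us" "tl vs"] b by force
      let ?P = "P(i := us @ P i, b := vs)"
      have e: "path_edges (us @ P i) = insert {s, y} (path_edges us \<union> path_edges (P i))"
        using path_edges_append[of us "P i"] uv y s Pi by (simp add: insert_commute)
      show thesis
      proof (rule that[of ?P])
        show "linear_forest r ?P" "forest_verts r ?P = forest_verts r P"
          using linear_forest_update2[OF lf i b(1) not_sym[OF False], of "us @ P i" vs]
            uv dis dbi Pi by auto
        show "forest_edges r ?P \<subseteq> insert {s, y} (forest_edges r P - {{p, y}})"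
          unfolding forest_edges_update2[OF i b(1) not_sym[OF False]] e U2 Pb
          using nin nus i False by auto
        show "forest_edges r P - {{p, y}} \<subseteq> forest_edges r ?P"
          unfolding forest_edges_update2[OF i b(1) not_sym[OF False]] e U2 Pb by auto
        show "\<exists>t. P l = ?P l @ t" if "i < l" "l < r" for l using that bi by auto
      qed
    qed
  qed
qed

subsection \<open>Rainbow linear forests with few paths\<close>

locale proper_colouring =
  fixes V :: "'a set" and c :: "'a set \<Rightarrow> 'c"
  assumes finite_V: "finite V"
    and proper: "u \<in> V \<Longrightarrow> v \<in> V \<Longrightarrow> w \<in> V \<Longrightarrow>
      u \<noteq> v \<Longrightarrow> u \<noteq> w \<Longrightarrow> c {u, v} = c {u, w} \<Longrightarrow> v = w"
begin

lemma proper_subset: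
  assumes "U \<subseteq> V"
  shows "proper_colouring U c"
proof
  show "finite U" using assms finite_V by (rule finite_subset)
  show "v = w" if "u \<in> U" "v \<in> U" "w \<in> U" "u \<noteq> v" "u \<noteq> w" "c {u, v} = c {u, w}" for u v w
    using proper[of u v w] that assms by auto
qed

text \<open>Colours at a vertex are distinct, so each forbidden colour excludes at most one
  neighbour. Most counts below rest on this.\<close>

lemma card_neighbours_le:
  assumes "s \<in> V" "N \<subseteq> V - {s}" "\<And>v. v \<in> N \<Longrightarrow> c {s, v} \<in> \<Phi>" "finite \<Phi>"
  shows "card N \<le> card \<Phi>"
proof (rule card_inj_on_le[of "\<lambda>v. c {s, v}"])
  show "inj_on (\<lambda>v. c {s, v}) N" using proper assms by (intro inj_onI) blast
qed (use assms in auto)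

text \<open>In a forest \<open>P\<close> of maximum coverage, let \<open>D\<close> consist of the vertices \<open>y\<close> for which rotations at the
  starts of the first \<open>i\<close> paths can free the colour of the edge from \<open>y\<close> to its predecessor \<open>p y\<close>.
  No free colour leads from the next start to an uncovered vertex, so \<open>D\<close> gains about
  \<open>card X - T\<close> vertices for each \<open>i\<close>, where \<open>X\<close> is the set of uncovered vertices. The paths not yet
  rotated stay prefixes of the original ones; this keeps their orientation, so that no rotation
  closes a cycle.\<close>

theorem rainbow_forest:
  assumes T: "\<And>v. v \<in> V \<Longrightarrow> card {w \<in> V - {v}. c {v, w} \<in> K} \<le> T"
    and r: "0 < r" "r \<le> card V"
  obtains P where "linear_forest r P" "forest_verts r P \<subseteq> V" "inj_on c (forest_edges r P)"
    "c ` forest_edges r P \<inter> K = {}" "r * card (V - forest_verts r P) \<le> r * T + card V"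
proof -
  define good where "good P \<longleftrightarrow> linear_forest r P \<and> forest_verts r P \<subseteq> V \<and>
    inj_on c (forest_edges r P) \<and> c ` forest_edges r P \<inter> K = {}" for P
  obtain h where h: "bij_betw h {..<card V} V"
    using ex_bij_betw_nat_finite[OF finite_V] by (auto simp: atLeast0LessThan)
  \<comment> \<open>\<open>r\<close> single vertices form an admissible forest, so one of maximum
    coverage exists.\<close>
  have "good (\<lambda>l. [h l])"
    unfolding good_def linear_forest_def forest_verts_def forest_edges_def
    using h r by (auto simp: bij_betw_def inj_on_def)
  moreover have "\<forall>P. good P \<longrightarrow> card (forest_verts r P) < Suc (card V)"
    using card_mono[OF finite_V] by (auto simp: good_def less_Suc_eq_le)
  ultimately obtain P where P: "good P"
    and maxi: "\<And>P'. good P' \<Longrightarrow> card (forest_verts r P') \<le> card (forest_verts r P)"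
    using ex_has_greatest_nat[of good "\<lambda>l. [h l]" "\<lambda>P. card (forest_verts r P)"] by blast
  define W E X where "W = forest_verts r P" and "E = forest_edges r P" and "X = V - W"
  have lf: "linear_forest r P" and WV: "W \<subseteq> V" and injE: "inj_on c E" and EK: "c ` E \<inter> K = {}"
    using P by (auto simp: good_def W_def E_def)
  note lfD = linear_forestD[OF lf]
  have fin: "finite W" "finite E" "finite X" using finite_V by (auto simp: W_def E_def X_def)
  have cardX: "card X + card W = card V"
    unfolding X_def using WV fin finite_V by (metis card_Diff_subset card_mono le_add_diff_inverse2)
  have cardE: "card E + r \<le> card W" using card_forest_edges_le[OF lf] by (simp add: E_def W_def)
  \<comment> \<open>The vertices with a predecessor: starts of paths are left out.\<close>
  define Y where "Y = W - (\<lambda>l. hd (P l)) ` {..<r}"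
  have "\<exists>x l us vs. l < r \<and> P l = us @ x # y # vs" if y: "y \<in> Y" for y
  proof -
    obtain l where l: "l < r" "y \<in> set (P l)" using y by (auto simp: Y_def W_def forest_verts_def)
    then obtain us vs where uv: "P l = us @ y # vs" by (meson split_list)
    have "us \<noteq> []"
    proof
      assume "us = []"
      then have "y = hd (P l)" using uv by simp
      then show False using y l by (auto simp: Y_def)
    qed
    then show ?thesis using uv l by (metis append_Cons append_Nil append_assoc append_butlast_last_id)
  qed
  then obtain p where p: "\<And>y. y \<in> Y \<Longrightarrow> \<exists>l us vs. l < r \<and> P l = us @ p y # y # vs" by metis
  define e where "e y = {p y, y}" for y
  have arc: "p y \<noteq> y \<and> e y \<in> E" if "y \<in> Y" for y
  proof -
    obtain l us vs where l: "l < r" "P l = us @ p y # y # vs" using p \<open>y \<in> Y\<close> by blast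
    have "e y \<in> path_edges (P l)"
      using path_edges_append[of "us @ [p y]" "y # vs"] l by (simp add: e_def)
    then have "e y \<in> E" using l(1) by (auto simp only: E_def forest_edges_def)
    then show ?thesis using lfD(2)[OF l(1)] l(2) by auto
  qed
  \<comment> \<open>The order \<open>y\<close>, \<open>p y\<close> never occurs in \<open>P\<close>,
    hence not in a prefix of one of its paths either. This supplies the hypothesis
    \<open>ord\<close> of \<open>rotate_forest\<close>.\<close>
  have noarc: False if "y \<in> Y" "l < r" "P l = us @ y # p y # vs" for y l us vs
  proof -
    obtain l' us' vs' where l': "l' < r" "P l' = us' @ p y # y # vs'" using p \<open>y \<in> Y\<close> by blast
    have "l = l'" using lfD(3)[OF that(2) l'(1)] that l' by auto
    then have "us @ y # p y # vs = (us' @ [p y]) @ y # vs'" using that l' by simp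
    moreover have "distinct (us @ y # p y # vs)" using lfD(2)[OF that(2)] that by simp
    moreover have "distinct ((us' @ [p y]) @ y # vs')" using lfD(2)[OF l'(1)] l' by simp
    ultimately have "us = us' @ [p y]"
      by (subst (asm) append_Cons_eq_iff) auto
    then show False using lfD(2)[OF that(2)] that by auto
  qed
  have inje: "inj_on e Y"
  proof (rule inj_onI, rule ccontr)
    fix y z assume yz: "y \<in> Y" "z \<in> Y" "e y = e z" "y \<noteq> z"
    then have "p y = z" "p z = y" by (auto simp: e_def doubleton_eq_iff)
    then show False using noarc[OF yz(1)] p[OF yz(2)] by metis
  qed
  have "\<exists>D. D \<subseteq> Y \<and> i * card X \<le> card D + i * T \<and> (\<forall>y\<in>D. \<exists>P'. linear_forest r P' \<and>
      forest_verts r P' = W \<and> inj_on c (forest_edges r P') \<and> c ` forest_edges r P' \<inter> K = {} \<and>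
      (\<forall>l. i \<le> l \<and> l < r \<longrightarrow> (\<exists>t. P l = P' l @ t)) \<and> E - e ` D \<subseteq> forest_edges r P' \<and>
      c (e y) \<notin> c ` forest_edges r P')" if "i \<le> r" for i
    using that
  proof (induction i)
    case 0
    show ?case by (intro exI[of _ "{}"]) auto
  next
    case (Suc i)
    then have ir: "i < r" by simp
    define ok where "ok D P' \<longleftrightarrow> linear_forest r P' \<and>
      forest_verts r P' = W \<and> inj_on c (forest_edges r P') \<and> c ` forest_edges r P' \<inter> K = {} \<and>
      (\<forall>l. i \<le> l \<and> l < r \<longrightarrow> (\<exists>t. P l = P' l @ t)) \<and> E - e ` D \<subseteq> forest_edges r P'" for D P'
    obtain D where D: "D \<subseteq> Y" "i * card X \<le> card D + i * T"
      "\<And>y. y \<in> D \<Longrightarrow> \<exists>P'. ok D P' \<and> c (e y) \<notin> c ` forest_edges r P'"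
      using Suc unfolding ok_def by (metis Suc_leD)
    define s where "s = hd (P i)"
    have sP: "s \<in> set (P i)" using lfD(1)[OF ir] by (simp add: s_def)
    then have sW: "s \<in> W" using ir by (auto simp: W_def forest_verts_def)
    \<comment> \<open>A colour missing from the undisturbed edges is either absent from
      \<open>P\<close> itself or the colour of some \<open>e y\<close> with \<open>y\<close> in
      \<open>D\<close>, so some forest avoids it.\<close>
    have gd: "\<exists>P'. ok D P' \<and> \<gamma> \<notin> c ` forest_edges r P'" if "\<gamma> \<notin> c ` (E - e ` D)" for \<gamma>
    proof (cases "\<gamma> \<in> c ` E")
      case True
      then show ?thesis using that D(3) by auto
    next
      case False
      have "ok D P" unfolding ok_def using lf injE EK by (auto simp: W_def E_def)
      then show ?thesis using False by (auto simp: E_def)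
    qed
    have hdP': "hd (P' i) = s" if P': "ok D P'" for P'
    proof -
      obtain t where "P i = P' i @ t" using P' ir by (auto simp: ok_def)
      moreover have "P' i \<noteq> []" using P' ir linear_forestD(1)[of r P' i] by (simp add: ok_def)
      ultimately show ?thesis by (simp add: s_def)
    qed
    \<comment> \<open>Otherwise \<open>x\<close> could be put in front of path \<open>i\<close> of a
      forest that avoids the colour, against maximality.\<close>
    have notX: "c {s, x} \<in> K \<or> c {s, x} \<in> c ` (E - e ` D)" if x: "x \<in> X" for x
    proof (rule ccontr)
      assume n: "\<not> ?thesis"
      then obtain P' where P': "ok D P'" "c {s, x} \<notin> c ` forest_edges r P'" using gd[of "c {s, x}"] by blast
      let ?P = "P'(i := x # P' i)"
      have lf': "linear_forest r P'" using P' by (simp add: ok_def)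
      have vs: "forest_verts r P' = W" using P' by (simp add: ok_def)
      have xn: "x \<notin> W" using x by (simp add: X_def)
      have ne: "P' i \<noteq> []" "distinct (P' i)" using linear_forestD[OF lf'] ir by auto
      have "x \<notin> set (P' i)" using xn vs ir by (auto simp: forest_verts_def)
      then have u: "linear_forest r ?P" "forest_verts r ?P = {x} \<union> W"
        using linear_forest_update[OF lf' ir, of "x # P' i" "{x}"] ne vs xn by auto
      have "path_edges (x # P' i) = insert {s, x} (path_edges (P' i))"
        using ne hdP'[OF P'(1)] by (cases "P' i") auto
      then have ed: "forest_edges r ?P = insert {s, x} (forest_edges r P')"
        using forest_edges_update[OF ir, of P' "x # P' i"] forest_edges_update[OF ir, of P' "P' i"]
        by auto
      have "good ?P" unfolding good_def ed u(2) using u(1) P' n WV x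
        by (auto simp: ok_def X_def)
      from maxi[OF this] show False using u(2) xn fin by (simp add: W_def)
    qed
    \<comment> \<open>The vertices at which \<open>s\<close> can rotate: by \<open>gd\<close> the
      colour needed is free in some forest.\<close>
    define N where "N = {y \<in> Y - {s}. c {s, y} \<notin> K \<and> c {s, y} \<notin> c ` (E - e ` D)}"
    have finY: "finite Y" using fin by (simp add: Y_def)
    have finN: "finite N" using finY by (simp add: N_def)
    have N: "\<exists>P'. linear_forest r P' \<and>
      forest_verts r P' = W \<and> inj_on c (forest_edges r P') \<and> c ` forest_edges r P' \<inter> K = {} \<and>
      (\<forall>l. Suc i \<le> l \<and> l < r \<longrightarrow> (\<exists>t. P l = P' l @ t)) \<and> E - e ` (D \<union> N) \<subseteq> forest_edges r P' \<and>
      c (e y) \<notin> c ` forest_edges r P'" if y: "y \<in> N - D" for y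
    proof -
      obtain P' where P': "ok D P'" "c {s, y} \<notin> c ` forest_edges r P'"
        using gd[of "c {s, y}"] y by (auto simp: N_def)
      have yY: "y \<in> Y" using y by (simp add: N_def)
      have "e y \<notin> e ` D" using inje yY D(1) y by (auto simp: inj_on_def)
      then have eE: "e y \<in> forest_edges r P'" using arc[OF yY] P' by (auto simp: ok_def)
      have no: "P' l \<noteq> us @ y # p y # vs" if l: "i \<le> l" "l < r" for l us vs
      proof
        assume "P' l = us @ y # p y # vs"
        moreover obtain t where "P l = P' l @ t" using P' l by (auto simp: ok_def)
        ultimately show False using noarc[OF yY l(2)] by auto
      qed
      have lf': "linear_forest r P'" using P' by (simp add: ok_def)
      have "{p y, y} \<in> forest_edges r P'" "p y \<noteq> y" "s = hd (P' i)" "{s, y} \<notin> forest_edges r P'"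
        using eE arc[OF yY] hdP'[OF P'(1)] P'(2) by (auto simp: e_def)
      from rotate_forest[OF lf' ir this no] obtain P'' where P'':
        "linear_forest r P''" "forest_verts r P'' = forest_verts r P'"
        "forest_edges r P'' \<subseteq> insert {s, y} (forest_edges r P' - {{p y, y}})"
        "forest_edges r P' - {{p y, y}} \<subseteq> forest_edges r P''"
        "\<And>l. i < l \<Longrightarrow> l < r \<Longrightarrow> \<exists>t. P' l = P'' l @ t" by blast
      have inj': "inj_on c (forest_edges r P')" using P' by (simp add: ok_def)
      have "inj_on c (insert {s, y} (forest_edges r P' - {{p y, y}}))"
        unfolding inj_on_insert using inj_on_diff[OF inj', of "{{p y, y}}"] P'(2) by blast
      then have "inj_on c (forest_edges r P'')" using P''(3) inj_on_subset by blast
      moreover have "c (e y) \<notin> c ` forest_edges r P''"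
      proof
        assume "c (e y) \<in> c ` forest_edges r P''"
        then obtain f where f: "f \<in> forest_edges r P''" "c f = c (e y)" by auto
        then have "f = {s, y} \<or> f \<in> forest_edges r P' \<and> f \<noteq> e y" using P''(3) by (auto simp: e_def)
        then show False using inj' eE f P'(2) by (auto simp: inj_on_def)
      qed
      moreover have "c ` forest_edges r P'' \<inter> K = {}"
        using P''(3) P' y by (auto simp: ok_def N_def)
      moreover have "\<exists>t. P l = P'' l @ t" if l: "Suc i \<le> l" "l < r" for l
      proof -
        obtain t where "P' l = P'' l @ t" using P''(5)[of l] l by auto
        moreover obtain t' where "P l = P' l @ t'"
          using P'(1) l unfolding ok_def by (meson Suc_leD)
        ultimately show ?thesis by auto
      qed
      moreover have "E - e ` (D \<union> N) \<subseteq> forest_edges r P''"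
      proof
        fix f assume f: "f \<in> E - e ` (D \<union> N)"
        then have "f \<in> forest_edges r P'" using P' by (auto simp: ok_def)
        moreover have "f \<noteq> {p y, y}" using f y by (auto simp: e_def)
        ultimately show "f \<in> forest_edges r P''" using P''(4) by blast
      qed
      ultimately show ?thesis using P'' P' by (auto simp: ok_def)
    qed
    \<comment> \<open>Of the card V - 1 vertices other than \<open>s\<close>, at most
      \<open>T\<close> are joined to it by reserved colours, at most card E - card D by colours of
      undisturbed edges, and at most r - 1 are other starts. All others lie in \<open>N\<close>,
      since \<open>notX\<close> places \<open>X\<close> in the first two groups; card E + r \<le>
      card W gives the claim.\<close>
    have count: "card X + card D \<le> card N + T"
    proof -
      let ?A = "{w \<in> V - {s}. c {s, w} \<in> K}"
      let ?B = "{w \<in> V - {s}. c {s, w} \<in> c ` (E - e ` D)}"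
      let ?S = "(\<lambda>l. hd (P l)) ` ({..<r} - {i})"
      have "V - {s} \<subseteq> ?A \<union> ?B \<union> ?S \<union> N"
      proof
        fix v assume v: "v \<in> V - {s}"
        show "v \<in> ?A \<union> ?B \<union> ?S \<union> N"
        proof (cases "v \<in> X")
          case True
          then show ?thesis using notX[of v] v by auto
        next
          case False
          then have "v \<in> W" using v by (simp add: X_def)
          then consider "v \<in> Y" | "v \<in> (\<lambda>l. hd (P l)) ` {..<r}" by (auto simp: Y_def)
          then show ?thesis
          proof cases
            case 2
            then show ?thesis using v by (auto simp: s_def)
          qed (use v in \<open>auto simp: N_def\<close>)
        qed
      qed
      moreover have finAB: "finite (?A \<union> ?B \<union> ?S \<union> N)" using finite_V finN by auto
      ultimately have "card (V - {s}) \<le> card (?A \<union> ?B \<union> ?S \<union> N)" by (intro card_mono)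
      also have "\<dots> \<le> card ?A + card ?B + card ?S + card N"
        using card_Un_le[of "?A \<union> ?B \<union> ?S" N] card_Un_le[of "?A \<union> ?B" ?S] card_Un_le[of ?A ?B]
        by linarith
      finally have 1: "card (V - {s}) \<le> card ?A + card ?B + card ?S + card N" .
      have 2: "card ?A \<le> T" using T sW WV by auto
      have "card ?B \<le> card (c ` (E - e ` D))"
        using sW WV fin by (intro card_neighbours_le) auto
      also have "\<dots> \<le> card (E - e ` D)" using fin by (intro card_image_le) auto
      also have "\<dots> = card E - card (e ` D)"
        using arc D(1) finite_subset[OF D(1) finY] by (intro card_Diff_subset) auto
      also have "card (e ` D) = card D" using inje D(1) by (metis card_image inj_on_subset)
      finally have 3: "card ?B \<le> card E - card D" .
      have "card D = card (e ` D)" using inje D(1) by (metis card_image inj_on_subset)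
      also have "\<dots> \<le> card E" using arc D(1) fin by (intro card_mono) auto
      finally have 4: "card D \<le> card E" .
      have "card ?S \<le> card ({..<r} - {i})" by (intro card_image_le) auto
      then have 5: "card ?S + 1 \<le> r" using ir by simp
      have 6: "card (V - {s}) + 1 = card V"
        using sW WV finite_V by (metis Suc_eq_plus1 card.remove in_mono)
      show ?thesis using 1 2 3 4 5 6 cardX cardE by linarith
    qed
    show ?case
    proof (intro exI[of _ "D \<union> N"] conjI)
      show "D \<union> N \<subseteq> Y" using D(1) by (auto simp: N_def)
      have "card N \<le> card (D \<union> N)" using finN finite_subset[OF D(1) finY] by (intro card_mono) auto
      then show "Suc i * card X \<le> card (D \<union> N) + Suc i * T"
        using count D(2) by (simp add: algebra_simps)
      show "\<forall>y\<in>D \<union> N. \<exists>P'. linear_forest r P' \<and>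
        forest_verts r P' = W \<and> inj_on c (forest_edges r P') \<and> c ` forest_edges r P' \<inter> K = {} \<and>
        (\<forall>l. Suc i \<le> l \<and> l < r \<longrightarrow> (\<exists>t. P l = P' l @ t)) \<and> E - e ` (D \<union> N) \<subseteq> forest_edges r P' \<and>
        c (e y) \<notin> c ` forest_edges r P'"
      proof
        fix y assume y: "y \<in> D \<union> N"
        show "\<exists>P'. linear_forest r P' \<and>
          forest_verts r P' = W \<and> inj_on c (forest_edges r P') \<and> c ` forest_edges r P' \<inter> K = {} \<and>
          (\<forall>l. Suc i \<le> l \<and> l < r \<longrightarrow> (\<exists>t. P l = P' l @ t)) \<and> E - e ` (D \<union> N) \<subseteq> forest_edges r P' \<and>
          c (e y) \<notin> c ` forest_edges r P'"
        proof (cases "y \<in> D")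
          case True
          then obtain P' where "ok D P'" "c (e y) \<notin> c ` forest_edges r P'" using D(3) by blast
          then show ?thesis unfolding ok_def by (intro exI[of _ P']) auto
        qed (use N y in auto)
      qed
    qed
  qed
  from this[OF order_refl] obtain D where D: "D \<subseteq> Y" "r * card X \<le> card D + r * T" by auto
  \<comment> \<open>\<open>D\<close> cannot outgrow \<open>V\<close>, so after all \<open>r\<close>
    rounds the gain per round, card X - T, is at most card V / r.\<close>
  have "card D \<le> card V" using D(1) WV finite_V by (intro card_mono) (auto simp: Y_def)
  then have "r * card X \<le> r * T + card V" using D(2) by linarith
  then show thesis using that[of P] P by (auto simp: good_def X_def W_def)
qed

end

subsection \<open>Hamiltonian rainbow cycles when few colours cover few edges\<close>

definition cycle_edges :: "'a list \<Rightarrow> 'a set set" where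
  "cycle_edges xs = insert {last xs, hd xs} (path_edges xs)"

lemma cycle_edges_append:
  "us \<noteq> [] \<Longrightarrow> vs \<noteq> [] \<Longrightarrow> cycle_edges (us @ vs) =
    insert {last us, hd vs} (insert {last vs, hd us} (path_edges us \<union> path_edges vs))"
  by (auto simp: cycle_edges_def path_edges_append)

text \<open>Any edge can be made the closing edge, the one that the 3-opt move replaces.\<close>

lemma cycle_edges_rotate:
  assumes "e \<in> cycle_edges xs"
  obtains ys where "set ys = set xs" "length ys = length xs" "cycle_edges ys = cycle_edges xs"
    "e = {last ys, hd ys}" "distinct ys = distinct xs"
proof (cases "e = {last xs, hd xs}")
  case False
  then obtain us vs where uv: "xs = us @ vs" "us \<noteq> []" "vs \<noteq> []" "e = {last us, hd vs}"
    using assms path_edges_split[of e xs] by (auto simp: cycle_edges_def)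
  have "cycle_edges (vs @ us) = cycle_edges xs"
    using uv cycle_edges_append[of us vs] cycle_edges_append[of vs us] by auto
  then show thesis using that[of "vs @ us"] uv by auto
qed (use that in blast)

lemma path_edges_nth: "path_edges xs = (\<lambda>i. {xs ! i, xs ! Suc i}) ` {..<length xs - 1}"
proof (induction xs rule: path_edges.induct)
  case (1 x y zs)
  have "{..<length (x # y # zs) - 1} = insert 0 (Suc ` {..<length (y # zs) - 1})"
    using lessThan_Suc_eq_insert_0[of "length zs"] by simp
  then show ?case using 1 by (simp add: image_image)
qed auto

lemma cycle_edges_nth:
  assumes "xs \<noteq> []"
  shows "cycle_edges xs = (\<lambda>i. {xs ! i, xs ! (Suc i mod length xs)}) ` {..<length xs}"
proof -
  obtain n where n: "length xs = Suc n" using assms by (metis Suc_pred length_greater_0_conv)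
  have "(\<lambda>i. {xs ! i, xs ! (Suc i mod length xs)}) ` {..<n} = path_edges xs"
    unfolding path_edges_nth by (rule image_cong) (auto simp: n)
  moreover have "{xs ! n, xs ! (Suc n mod length xs)} = {last xs, hd xs}"
    using n assms by (simp add: last_conv_nth hd_conv_nth)
  moreover have "{..<length xs} = insert n {..<n}" using n by auto
  ultimately show ?thesis unfolding cycle_edges_def by simp
qed

lemma finite_cycle_edges: "finite (cycle_edges xs)"
  by (simp add: cycle_edges_def finite_path_edges)

lemma card_cycle_edges_le: "xs \<noteq> [] \<Longrightarrow> card (cycle_edges xs) \<le> length xs"
  by (metis card_image_le card_lessThan cycle_edges_nth finite_lessThan)

lemma cycle_edges_subset: "xs \<noteq> [] \<Longrightarrow> e \<in> cycle_edges xs \<Longrightarrow> e \<subseteq> set xs"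
  using path_edges_subset by (fastforce simp: cycle_edges_def)

lemma split_list_three:
  assumes "i < j" "Suc j < length Q"
  obtains A B C where "Q = A @ B @ C" "A \<noteq> []" "B \<noteq> []" "C \<noteq> []"
    "last A = Q ! i" "hd B = Q ! Suc i" "last B = Q ! j" "hd C = Q ! Suc j"
proof
  let ?A = "take (Suc i) Q" and ?B = "take (j - i) (drop (Suc i) Q)" and ?C = "drop (Suc j) Q"
  have "drop (Suc j) Q = drop (j - i) (drop (Suc i) Q)" using assms by simp
  then show "Q = ?A @ ?B @ ?C" by (metis append_take_drop_id)
  show "?A \<noteq> []" "?B \<noteq> []" "?C \<noteq> []" using assms by auto
  show "last ?A = Q ! i" using assms by (subst last_conv_nth) (auto simp: min_def)
  show "hd ?B = Q ! Suc i" using assms by (subst hd_conv_nth) auto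
  show "last ?B = Q ! j" using assms by (subst last_conv_nth) (auto simp: min_def)
  show "hd ?C = Q ! Suc j" using assms by (subst hd_conv_nth) auto
qed

lemma card_nth_index_le:
  assumes "distinct xs" "finite B" "I \<subseteq> {..<length xs}" "\<And>i. i \<in> I \<Longrightarrow> xs ! i \<in> B"
  shows "card I \<le> card B"
proof (rule card_inj_on_le[of "(!) xs"])
  show "inj_on ((!) xs) I"
    using assms(1,3) by (intro inj_onI) (metis lessThan_iff nth_eq_iff_index_eq subsetD)
qed (use assms in auto)

lemma card_cycle_edges_meeting_le:
  assumes "distinct xs" "xs \<noteq> []" "finite B"
  shows "card {e \<in> cycle_edges xs. e \<inter> B \<noteq> {}} \<le> 2 * card B"
proof -
  let ?f = "\<lambda>i. {xs ! i, xs ! (Suc i mod length xs)}"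
  let ?I = "{i. i < length xs \<and> xs ! i \<in> B}"
  let ?J = "{i. i < length xs \<and> xs ! (Suc i mod length xs) \<in> B}"
  have len: "0 < length xs" using assms by simp
  have "{e \<in> cycle_edges xs. e \<inter> B \<noteq> {}} \<subseteq> ?f ` (?I \<union> ?J)"
    using cycle_edges_nth[OF assms(2)] by auto
  then have "card {e \<in> cycle_edges xs. e \<inter> B \<noteq> {}} \<le> card (?f ` (?I \<union> ?J))"
    by (intro card_mono) auto
  also have "\<dots> \<le> card (?I \<union> ?J)" by (intro card_image_le) auto
  also have "\<dots> \<le> card ?I + card ?J" by (rule card_Un_le)
  also have "card ?I \<le> card B" using assms by (intro card_nth_index_le) auto
  also have "card ?J \<le> card B"
  proof -
    have "inj_on (\<lambda>i. Suc i mod length xs) {..<length xs}"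
      by (intro inj_onI) (auto simp: mod_Suc split: if_splits)
    then have "card ((\<lambda>i. Suc i mod length xs) ` ?J) = card ?J"
      by (intro card_image) (auto elim: inj_on_subset)
    moreover have "card ((\<lambda>i. Suc i mod length xs) ` ?J) \<le> card B"
      using assms len by (intro card_nth_index_le) auto
    ultimately show ?thesis by simp
  qed
  finally show ?thesis by simp
qed

text \<open>An element of \<open>B\<close> spoils at most two of the consecutive pairs.\<close>

lemma consecutive_outside:
  assumes "distinct xs" "finite B" "2 * card B + 1 < length xs"
  obtains us vs where "xs = us @ vs" "us \<noteq> []" "vs \<noteq> []" "last us \<notin> B" "hd vs \<notin> B"
proof -
  let ?n = "length xs - 1"
  have "\<exists>i<?n. xs ! i \<notin> B \<and> xs ! Suc i \<notin> B"
  proof (rule ccontr)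
    assume "\<not> ?thesis"
    then have "{..<?n} \<subseteq> {i. i < ?n \<and> xs ! i \<in> B} \<union> {i. i < ?n \<and> xs ! Suc i \<in> B}" by auto
    then have "?n \<le> card ({i. i < ?n \<and> xs ! i \<in> B} \<union> {i. i < ?n \<and> xs ! Suc i \<in> B})"
      using card_mono[of "{i. i < ?n \<and> xs ! i \<in> B} \<union> {i. i < ?n \<and> xs ! Suc i \<in> B}" "{..<?n}"]
      by simp
    also have "\<dots> \<le> card {i. i < ?n \<and> xs ! i \<in> B} + card {i. i < ?n \<and> xs ! Suc i \<in> B}"
      by (rule card_Un_le)
    also have "card {i. i < ?n \<and> xs ! i \<in> B} \<le> card B"
      using assms by (intro card_nth_index_le) auto
    also have "card {i. i < ?n \<and> xs ! Suc i \<in> B} = card (Suc ` {i. i < ?n \<and> xs ! Suc i \<in> B})"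
      by (simp add: card_image)
    also have "\<dots> \<le> card B" using assms by (intro card_nth_index_le) auto
    finally show False using assms(3) by linarith
  qed
  then obtain i where i: "Suc i < length xs" "xs ! i \<notin> B" "xs ! Suc i \<notin> B" by force
  show thesis
  proof (rule that[of "take (Suc i) xs" "drop (Suc i) xs"])
    show "last (take (Suc i) xs) \<notin> B"
      using i by (subst last_conv_nth) (auto simp: min_def)
    show "hd (drop (Suc i) xs) \<notin> B" using i by (subst hd_conv_nth) auto
  qed (use i in auto)
qed

context proper_colouring
begin

text \<open>Ordered pairs, so that the cardinality is exactly the sum of the degrees; every edge
  counts twice.\<close>

definition coloured_pairs :: "'c set \<Rightarrow> ('a \<times> 'a) set" where
  "coloured_pairs \<Phi> = {(u, v). u \<in> V \<and> v \<in> V \<and> u \<noteq> v \<and> c {u, v} \<in> \<Phi>}"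

abbreviation nbrs :: "'c set \<Rightarrow> 'a \<Rightarrow> 'a set" where
  "nbrs \<Phi> v \<equiv> {w \<in> V - {v}. c {v, w} \<in> \<Phi>}"

lemma finite_coloured_pairs: "finite (coloured_pairs \<Phi>)"
  by (rule finite_subset[of _ "V \<times> V"]) (auto simp: coloured_pairs_def finite_V)

text \<open>Markov's inequality for the degrees in the colours of \<Phi>.\<close>

lemma card_high_degree_le:
  "card {v \<in> V. g < card (nbrs \<Phi> v)} * Suc g \<le> card (coloured_pairs \<Phi>)"
proof -
  have "card {v \<in> V. g < card (nbrs \<Phi> v)} * Suc g = (\<Sum>v\<in>{v \<in> V. g < card (nbrs \<Phi> v)}. Suc g)"
    by simp
  also have "\<dots> \<le> (\<Sum>v\<in>{v \<in> V. g < card (nbrs \<Phi> v)}. card (nbrs \<Phi> v))"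
    by (intro sum_mono) auto
  also have "\<dots> \<le> (\<Sum>v\<in>V. card (nbrs \<Phi> v))" using finite_V by (intro sum_mono2) auto
  also have "\<dots> = card (SIGMA v:V. nbrs \<Phi> v)" using finite_V by (intro card_SigmaI[symmetric]) auto
  also have "(SIGMA v:V. nbrs \<Phi> v) = coloured_pairs \<Phi>" by (auto simp: coloured_pairs_def)
  finally show ?thesis .
qed

text \<open>Reversing a segment (2-opt) would not do: in the colouring of \<open>\<int>/n\<close> by sums, the two new edges
  may have equal colours for all choices. The 3-opt move \<open>A @ B @ C \<mapsto> A @ C @ B\<close> has a quadratic
  number of choices, of which only linearly many create a coincidence between two new edges.\<close>

lemma three_opt:
  assumes Q: "distinct Q" "set Q \<subseteq> V" "2 * h < length Q" "0 < h"
    and close: "c {last Q, hd Q} \<in> \<Phi>"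
    and deg: "card (nbrs \<Phi> (last Q)) \<le> g" "card (nbrs \<Phi> (hd Q)) \<le> g"
    and E: "card (coloured_pairs \<Phi>) \<le> E" "(2 * g + 3) * h + E < h * h"
  obtains Q' e1 e2 e3 where "distinct Q'" "set Q' = set Q"
    "cycle_edges Q' \<subseteq> (cycle_edges Q - {{last Q, hd Q}}) \<union> {e1, e2, e3}"
    "distinct [c e1, c e2, c e3]" "c e1 \<notin> \<Phi>" "c e2 \<notin> \<Phi>" "c e3 \<notin> \<Phi>"
proof -
  define a b where "a = last Q" and "b = hd Q"
  have ne: "Q \<noteq> []" using Q by auto
  define M where "M = length Q - 1"
  have M: "length Q = Suc M" "2 * h \<le> M" using Q by (auto simp: M_def)
  have a: "a = Q ! M" using ne by (simp add: a_def last_conv_nth M_def)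
  have b: "b = Q ! 0" using ne by (simp add: b_def hd_conv_nth)
  have QV: "Q ! i \<in> V" if "i \<le> M" for i using Q(2) that M by auto
  have Qeq: "Q ! i = Q ! j \<longleftrightarrow> i = j" if "i \<le> M" "j \<le> M" for i j
    using Q(1) that M by (simp add: nth_eq_iff_index_eq)
  have Qp: "j = k" if "i \<le> M" "j \<le> M" "k \<le> M" "i \<noteq> j" "i \<noteq> k" "c {Q ! i, Q ! j} = c {Q ! i, Q ! k}"
    for i j k
    using proper[OF QV QV QV, of i j k] Qeq that by simp
  \<comment> \<open>The cut positions \<open>i\<close> and \<open>j\<close> come from consecutive
    blocks of length \<open>h\<close>, which makes \<open>i < j\<close> automatic and gives h * h
    choices.\<close>
  define I J where "I = {..<h}" and "J = {h..<2 * h}"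
  have cIJ: "card I = h" "card J = h" "finite I" "finite J" by (auto simp: I_def J_def)
  \<comment> \<open>\<open>B1\<close> to \<open>B3\<close> are the choices where a new edge has a
    colour of \<Phi>, \<open>B4\<close> to \<open>B6\<close> those where two new edges agree. In the
    latter one index determines the other by properness, hence at most \<open>h\<close> choices
    each.\<close>
  define B1 where "B1 = {i \<in> I. c {a, Q ! Suc i} \<in> \<Phi>} \<times> J"
  define B2 where "B2 = I \<times> {j \<in> J. c {b, Q ! j} \<in> \<Phi>}"
  define B3 where "B3 = {(i, j). i \<in> I \<and> j \<in> J \<and> c {Q ! i, Q ! Suc j} \<in> \<Phi>}"
  define B4 where "B4 = {(i, j). i \<in> I \<and> j \<in> J \<and> c {a, Q ! Suc i} = c {b, Q ! j}}"
  define B5 where "B5 = {(i, j). i \<in> I \<and> j \<in> J \<and> c {a, Q ! Suc i} = c {Q ! i, Q ! Suc j}}"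
  define B6 where "B6 = {(i, j). i \<in> I \<and> j \<in> J \<and> c {b, Q ! j} = c {Q ! i, Q ! Suc j}}"
  have sub: "B1 \<union> B2 \<union> B3 \<union> B4 \<union> B5 \<union> B6 \<subseteq> I \<times> J"
    by (auto simp: B1_def B2_def B3_def B4_def B5_def B6_def)
  have "card {i \<in> I. c {a, Q ! Suc i} \<in> \<Phi>} \<le> card (nbrs \<Phi> a)"
  proof (rule card_inj_on_le[of "\<lambda>i. Q ! Suc i"])
    show "inj_on (\<lambda>i. Q ! Suc i) {i \<in> I. c {a, Q ! Suc i} \<in> \<Phi>}"
      using M by (intro inj_onI) (auto simp: I_def Qeq)
    show "(\<lambda>i. Q ! Suc i) ` {i \<in> I. c {a, Q ! Suc i} \<in> \<Phi>} \<subseteq> nbrs \<Phi> a"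
      using M Q(4) by (auto simp: I_def a Qeq intro!: QV)
  qed (use finite_V in auto)
  then have 1: "card B1 \<le> g * h" using deg by (simp add: B1_def card_cartesian_product cIJ a_def)
  have "card {j \<in> J. c {b, Q ! j} \<in> \<Phi>} \<le> card (nbrs \<Phi> b)"
  proof (rule card_inj_on_le[of "\<lambda>j. Q ! j"])
    show "inj_on (\<lambda>j. Q ! j) {j \<in> J. c {b, Q ! j} \<in> \<Phi>}"
      using M by (intro inj_onI) (auto simp: J_def Qeq)
    show "(\<lambda>j. Q ! j) ` {j \<in> J. c {b, Q ! j} \<in> \<Phi>} \<subseteq> nbrs \<Phi> b"
      using M Q(4) by (auto simp: J_def b Qeq intro!: QV)
  qed (use finite_V in auto)
  then have 2: "card B2 \<le> g * h"
    using deg by (simp add: B2_def card_cartesian_product cIJ b_def mult.commute)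
  have "card B3 \<le> card (coloured_pairs \<Phi>)"
  proof (rule card_inj_on_le[of "\<lambda>(i, j). (Q ! i, Q ! Suc j)"])
    show "inj_on (\<lambda>(i, j). (Q ! i, Q ! Suc j)) B3"
      using M by (intro inj_onI) (auto simp: B3_def I_def J_def Qeq)
    show "(\<lambda>(i, j). (Q ! i, Q ! Suc j)) ` B3 \<subseteq> coloured_pairs \<Phi>"
      using M by (auto simp: B3_def I_def J_def coloured_pairs_def Qeq intro!: QV)
  qed (rule finite_coloured_pairs)
  then have 3: "card B3 \<le> E" using E by simp
  have 4: "card B4 \<le> h"
  proof -
    have "inj_on fst B4"
    proof (intro inj_onI)
      fix p q assume pq: "p \<in> B4" "q \<in> B4" "fst p = fst q"
      then have "c {Q ! 0, Q ! snd p} = c {Q ! 0, Q ! snd q}" by (auto simp: B4_def b)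
      then have "snd p = snd q" using Qp[of 0 "snd p" "snd q"] pq M Q(4) by (auto simp: B4_def J_def)
      then show "p = q" using pq by (auto simp: prod_eq_iff)
    qed
    moreover have "fst ` B4 \<subseteq> I" by (auto simp: B4_def)
    ultimately show ?thesis using card_inj_on_le[of fst B4 I] cIJ by simp
  qed
  have 5: "card B5 \<le> h"
  proof -
    have "inj_on fst B5"
    proof (intro inj_onI)
      fix p q assume pq: "p \<in> B5" "q \<in> B5" "fst p = fst q"
      then have "c {Q ! fst p, Q ! Suc (snd p)} = c {Q ! fst p, Q ! Suc (snd q)}"
        by (auto simp: B5_def)
      then have "snd p = snd q" using Qp[of "fst p" "Suc (snd p)" "Suc (snd q)"] pq M
        by (auto simp: B5_def J_def I_def)
      then show "p = q" using pq by (auto simp: prod_eq_iff)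
    qed
    moreover have "fst ` B5 \<subseteq> I" by (auto simp: B5_def)
    ultimately show ?thesis using card_inj_on_le[of fst B5 I] cIJ by simp
  qed
  have 6: "card B6 \<le> h"
  proof -
    have "inj_on snd B6"
    proof (intro inj_onI)
      fix p q assume pq: "p \<in> B6" "q \<in> B6" "snd p = snd q"
      then have "c {Q ! Suc (snd p), Q ! fst p} = c {Q ! Suc (snd p), Q ! fst q}"
        by (auto simp: B6_def insert_commute)
      then have "fst p = fst q" using Qp[of "Suc (snd p)" "fst p" "fst q"] pq M
        by (auto simp: B6_def J_def I_def)
      then show "p = q" using pq by (auto simp: prod_eq_iff)
    qed
    moreover have "snd ` B6 \<subseteq> J" by (auto simp: B6_def)
    ultimately show ?thesis using card_inj_on_le[of snd B6 J] cIJ by simp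
  qed
  have "card (B1 \<union> B2 \<union> B3 \<union> B4 \<union> B5 \<union> B6)
      \<le> card B1 + card B2 + card B3 + card B4 + card B5 + card B6"
    using card_Un_le[of "B1 \<union> B2 \<union> B3 \<union> B4 \<union> B5" B6] card_Un_le[of "B1 \<union> B2 \<union> B3 \<union> B4" B5]
      card_Un_le[of "B1 \<union> B2 \<union> B3" B4] card_Un_le[of "B1 \<union> B2" B3] card_Un_le[of B1 B2]
    by linarith
  also have "\<dots> \<le> (2 * g + 3) * h + E" using 1 2 3 4 5 6 by (simp add: algebra_simps)
  also have "\<dots> < h * h" by (rule E)
  also have "\<dots> = card (I \<times> J)" by (simp add: card_cartesian_product cIJ)
  finally have "B1 \<union> B2 \<union> B3 \<union> B4 \<union> B5 \<union> B6 \<noteq> I \<times> J" by auto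
  then obtain i j where ij: "i \<in> I" "j \<in> J" "(i, j) \<notin> B1 \<union> B2 \<union> B3 \<union> B4 \<union> B5 \<union> B6"
    using sub by blast
  have lt: "i < j" "Suc j < length Q" using ij M Q(4) by (auto simp: I_def J_def)
  obtain A B C where ABC: "Q = A @ B @ C" "A \<noteq> []" "B \<noteq> []" "C \<noteq> []"
    "last A = Q ! i" "hd B = Q ! Suc i" "last B = Q ! j" "hd C = Q ! Suc j"
    using split_list_three[OF lt] by metis
  let ?e1 = "{Q ! i, Q ! Suc j}" and ?e2 = "{a, Q ! Suc i}" and ?e3 = "{b, Q ! j}"
  have cols: "c ?e1 \<notin> \<Phi>" "c ?e2 \<notin> \<Phi>" "c ?e3 \<notin> \<Phi>" "distinct [c ?e1, c ?e2, c ?e3]"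
    using ij by (auto simp: B1_def B2_def B3_def B4_def B5_def B6_def)
  have lh: "last C = a" "hd A = b" using ABC by (auto simp: a_def b_def)
  have eQ': "cycle_edges (A @ C @ B) =
      {?e1, ?e2, ?e3} \<union> (path_edges A \<union> path_edges C \<union> path_edges B)"
    using ABC lh by (auto simp: cycle_edges_append path_edges_append insert_commute)
  have eQ: "path_edges A \<union> path_edges C \<union> path_edges B \<subseteq> cycle_edges Q"
    using ABC by (auto simp: cycle_edges_append path_edges_append)
  have "{a, b} \<notin> path_edges A \<union> path_edges C \<union> path_edges B"
  proof -
    have "a \<in> set C" "b \<in> set A" using lh ABC by auto
    then have "a \<notin> set A" "a \<notin> set B" "b \<notin> set C" using Q(1) ABC(1) by auto
    then show ?thesis using path_edges_subset[of "{a,b}" A] path_edges_subset[of "{a,b}" B]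
        path_edges_subset[of "{a,b}" C] by auto
  qed
  then have "path_edges A \<union> path_edges C \<union> path_edges B \<subseteq> cycle_edges Q - {{last Q, hd Q}}"
    using eQ unfolding a_def b_def by (simp only: subset_Diff_insert Diff_empty simp_thms)
  then have sub: "cycle_edges (A @ C @ B) \<subseteq> (cycle_edges Q - {{last Q, hd Q}}) \<union> {?e1, ?e2, ?e3}"
    unfolding eQ' by (rule Un_least[OF Un_upper2 order.trans[OF _ Un_upper1]])
  have "distinct (A @ C @ B)" "set (A @ C @ B) = set Q" using Q(1) ABC(1) by auto
  from that[OF this sub cols(4,1,2,3)] show thesis .
qed

text \<open>Each 3-opt move removes one edge of \<open>Y\<close>, the edges blamed for repetitions,
  and brings in at most three new colours. So the number of colours outside \<Phi> plus 3 * card Y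
  does not grow; it stays at most \<open>s\<close>, and degrees in the current colours stay at most
  g + s at the ends of edges of \<open>Y\<close>.\<close>

lemma repair_cycle:
  assumes "distinct Q" "set Q \<subseteq> V" "2 * h < length Q" "0 < h"
    and "finite Y" "inj_on c (cycle_edges Q - Y)"
    and "\<And>e v. e \<in> Y \<Longrightarrow> v \<in> e \<Longrightarrow> card (nbrs \<Phi> v) \<le> g"
    and "card (c ` cycle_edges Q - \<Phi>) + 3 * card Y \<le> s"
    and E: "\<And>\<Psi>. finite \<Psi> \<Longrightarrow> card \<Psi> \<le> card V \<Longrightarrow> card (coloured_pairs \<Psi>) \<le> E"
    and hE: "(2 * (g + s) + 3) * h + E < h * h"
  shows "\<exists>Q'. distinct Q' \<and> set Q' = set Q \<and> inj_on c (cycle_edges Q')"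
  using assms(1-8)
proof (induction "card Y" arbitrary: Q Y)
  case 0
  then show ?case by auto
next
  case (Suc n)
  show ?case
  proof (cases "Y \<inter> cycle_edges Q = {}")
    case True
    then have "cycle_edges Q - Y = cycle_edges Q" by auto
    then show ?thesis using Suc.prems by metis
  next
    case False
    then obtain e where e: "e \<in> Y" "e \<in> cycle_edges Q" by auto
    obtain Q0 where Q0: "set Q0 = set Q" "length Q0 = length Q" "cycle_edges Q0 = cycle_edges Q"
      "e = {last Q0, hd Q0}" "distinct Q0"
      using cycle_edges_rotate[OF e(2)] Suc.prems(1) by metis
    \<comment> \<open>The move is made against all current colours, not only \<Phi>, so its three
      edges create no new repetition.\<close>
    let ?\<Psi> = "c ` cycle_edges Q"
    have ne: "Q \<noteq> []" using Suc.prems by auto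
    have fin: "finite ?\<Psi>" by (simp add: finite_cycle_edges)
    have "card ?\<Psi> \<le> card (cycle_edges Q)" by (intro card_image_le finite_cycle_edges)
    also have "\<dots> \<le> length Q" by (rule card_cycle_edges_le[OF ne])
    also have "\<dots> = card (set Q)" using Suc.prems(1) by (simp add: distinct_card)
    also have "\<dots> \<le> card V" using finite_V Suc.prems(2) by (intro card_mono)
    finally have card\<Psi>: "card ?\<Psi> \<le> card V" .
    have deg: "card (nbrs ?\<Psi> v) \<le> g + s" if "v \<in> e" for v
    proof -
      have vV: "v \<in> V" using that e(2) cycle_edges_subset[OF ne] Suc.prems(2) by blast
      have "card (nbrs ?\<Psi> v) \<le> card (nbrs \<Phi> v \<union> nbrs (?\<Psi> - \<Phi>) v)"
        using finite_V by (intro card_mono) auto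
      also have "\<dots> \<le> card (nbrs \<Phi> v) + card (nbrs (?\<Psi> - \<Phi>) v)" by (rule card_Un_le)
      also have "card (nbrs (?\<Psi> - \<Phi>) v) \<le> card (?\<Psi> - \<Phi>)"
        using vV fin by (intro card_neighbours_le) auto
      also have "card (nbrs \<Phi> v) \<le> g" using Suc.prems(7) e that by blast
      finally show ?thesis using Suc.prems(8) by linarith
    qed
    have hyps: "card (coloured_pairs ?\<Psi>) \<le> E" "card (nbrs ?\<Psi> (last Q0)) \<le> g + s"
      "card (nbrs ?\<Psi> (hd Q0)) \<le> g + s" "c {last Q0, hd Q0} \<in> ?\<Psi>"
      "set Q0 \<subseteq> V" "2 * h < length Q0"
      using E[OF fin card\<Psi>] deg e(2) Q0 Suc.prems by auto
    from three_opt[OF Q0(5) hyps(5,6) Suc.prems(4) hyps(4,2,3,1) hE]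
    obtain Q' e1 e2 e3 where Q': "distinct Q'" "set Q' = set Q0"
      "cycle_edges Q' \<subseteq> (cycle_edges Q0 - {{last Q0, hd Q0}}) \<union> {e1, e2, e3}"
      "distinct [c e1, c e2, c e3]" "c e1 \<notin> ?\<Psi>" "c e2 \<notin> ?\<Psi>" "c e3 \<notin> ?\<Psi>"
      by blast
    have sub: "cycle_edges Q' \<subseteq> (cycle_edges Q - {e}) \<union> {e1, e2, e3}" using Q'(3) Q0 by simp
    have "\<exists>Q''. distinct Q'' \<and> set Q'' = set Q' \<and> inj_on c (cycle_edges Q'')"
    proof (rule Suc.hyps(1)[of "Y - {e}" Q'])
      show "n = card (Y - {e})" using Suc.hyps(2) e(1) Suc.prems(5) by simp
      show "set Q' \<subseteq> V" using Q' Q0 Suc.prems by simp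
      have "length Q' = length Q" using Q' Q0 Suc.prems(1) by (metis distinct_card)
      then show "2 * h < length Q'" using Suc.prems(3) by simp
      have "inj_on c ((cycle_edges Q - Y) \<union> {e1, e2, e3})"
      proof -
        have ne: "c e1 \<noteq> c e2" "c e1 \<noteq> c e3" "c e2 \<noteq> c e3" using Q'(4) by auto
        have "c ei \<notin> c ` (cycle_edges Q - Y)" if "c ei \<notin> ?\<Psi>" for ei using that by blast
        from this[OF Q'(5)] this[OF Q'(6)] this[OF Q'(7)] show ?thesis
          unfolding Un_insert_right Un_empty_right inj_on_insert
          using Suc.prems(6) ne by blast
      qed
      then show "inj_on c (cycle_edges Q' - (Y - {e}))"
        by (rule inj_on_subset) (use sub in auto)
      have "card (c ` cycle_edges Q' - \<Phi>) \<le> card ((?\<Psi> - \<Phi>) \<union> {c e1, c e2, c e3})"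
        using sub fin by (intro card_mono) auto
      also have "\<dots> \<le> card (?\<Psi> - \<Phi>) + card {c e1, c e2, c e3}" by (rule card_Un_le)
      also have "card {c e1, c e2, c e3} \<le> 3" using Q'(4) by simp
      finally have "card (c ` cycle_edges Q' - \<Phi>) \<le> card (?\<Psi> - \<Phi>) + 3" by simp
      moreover have "card Y = Suc (card (Y - {e}))"
        by (rule card.remove[OF Suc.prems(5) e(1)])
      ultimately show "card (c ` cycle_edges Q' - \<Phi>) + 3 * card (Y - {e}) \<le> s"
        using Suc.prems(8) by linarith
    qed (use Q' Suc.prems in auto)
    then show ?thesis using Q' Q0 by auto
  qed
qed

text \<open>Inserting \<open>x\<close> between neighbours \<open>p\<close> and \<open>q\<close>
  repeats at most two colours, and the two old edges concerned can be repaired if their ends have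
  low degree in the colours of the cycle. By Markov few vertices have high degree, so a suitable
  pair exists on a long cycle.\<close>

lemma extend_rainbow_cycle:
  assumes Q: "distinct Q" "set Q \<subseteq> V" "2 * h \<le> length Q" "0 < h" "inj_on c (cycle_edges Q)"
    and x: "x \<in> V" "x \<notin> set Q"
    and E: "\<And>\<Psi>. finite \<Psi> \<Longrightarrow> card \<Psi> \<le> card V \<Longrightarrow> card (coloured_pairs \<Psi>) \<le> E"
    and hE: "(2 * (g + 8) + 3) * h + E < h * h"
    and g: "\<And>b. b * Suc g \<le> E \<Longrightarrow> 4 * b + 1 < length Q"
  shows "\<exists>Q'. distinct Q' \<and> set Q' = insert x (set Q) \<and> inj_on c (cycle_edges Q')"
proof -
  have ne: "Q \<noteq> []" using Q by auto
  define \<Phi> where "\<Phi> = c ` cycle_edges Q"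
  have fin: "finite \<Phi>" by (simp add: \<Phi>_def finite_cycle_edges)
  have "card \<Phi> \<le> card (cycle_edges Q)" unfolding \<Phi>_def by (intro card_image_le finite_cycle_edges)
  also have "\<dots> \<le> length Q" by (rule card_cycle_edges_le[OF ne])
  also have "\<dots> = card (set Q)" using Q(1) by (simp add: distinct_card)
  also have "\<dots> \<le> card V" using finite_V Q(2) by (intro card_mono)
  finally have card\<Phi>: "card \<Phi> \<le> card V" .
  define B where "B = {v \<in> V. g < card (nbrs \<Phi> v)}"
  have finB: "finite B" using finite_V by (simp add: B_def)
  have "card B * Suc g \<le> E"
    using card_high_degree_le[of g \<Phi>] E[OF fin card\<Phi>] by (simp add: B_def)
  then have cardB: "4 * card B + 1 < length Q" by (rule g)
  \<comment> \<open>Bad positions for a neighbour of \<open>x\<close>. A cycle edge meeting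
    \<open>B\<close> spoils at most one \<open>w\<close>, and there are at most 2 * card B such
    edges.\<close>
  define S where "S = {w \<in> set Q. \<exists>e\<in>cycle_edges Q. c e = c {x, w} \<and> e \<inter> B \<noteq> {}}"
  have "card S \<le> card (c ` {e \<in> cycle_edges Q. e \<inter> B \<noteq> {}})"
  proof (rule card_neighbours_le[OF x(1)])
    show "c {x, w} \<in> c ` {e \<in> cycle_edges Q. e \<inter> B \<noteq> {}}" if "w \<in> S" for w
    proof -
      obtain e where "e \<in> cycle_edges Q" "c e = c {x, w}" "e \<inter> B \<noteq> {}"
        using \<open>w \<in> S\<close> by (auto simp: S_def)
      then show ?thesis by (metis (mono_tags, lifting) imageI mem_Collect_eq)
    qed
  qed (use x Q(2) finite_cycle_edges[of Q] in \<open>auto simp: S_def\<close>)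
  also have "\<dots> \<le> card {e \<in> cycle_edges Q. e \<inter> B \<noteq> {}}"
    using finite_cycle_edges[of Q] by (intro card_image_le) auto
  also have "\<dots> \<le> 2 * card B" by (rule card_cycle_edges_meeting_le[OF Q(1) ne finB])
  finally have "2 * card S + 1 < length Q" using cardB by linarith
  then obtain us vs where uv: "Q = us @ vs" "us \<noteq> []" "vs \<noteq> []" "last us \<notin> S" "hd vs \<notin> S"
    using consecutive_outside[OF Q(1), of S] by (auto simp: S_def)
  define p q where "p = last us" and "q = hd vs"
  have pq: "p \<in> set Q" "q \<in> set Q" "p \<noteq> q"
    using uv Q(1) last_in_set[of us] hd_in_set[of vs] unfolding p_def q_def
    by (auto simp del: last_in_set hd_in_set)
  define Q0 where "Q0 = us @ x # vs"
  have eQ0: "cycle_edges Q0 \<subseteq> cycle_edges Q \<union> {{x, p}, {x, q}}"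
    using uv path_edges_append[of "[x]" vs]
    by (auto simp: Q0_def cycle_edges_append p_def q_def insert_commute)
  define Y where "Y = {e \<in> cycle_edges Q. c e = c {x, p} \<or> c e = c {x, q}}"
  have "card Y \<le> card {c {x, p}, c {x, q}}"
    by (rule card_inj_on_le[of c]) (use Q(5) in \<open>auto simp: Y_def inj_on_def\<close>)
  also have "\<dots> \<le> 2" by (simp add: card_insert_if)
  finally have cardY: "card Y \<le> 2" .
  have cxpq: "c {x, p} \<noteq> c {x, q}" using proper[of x p q] x pq Q(2) by auto
  have "\<exists>Q'. distinct Q' \<and> set Q' = set Q0 \<and> inj_on c (cycle_edges Q')"
  \<comment> \<open>The budget 8 is two new colours at \<open>x\<close> plus three for each of at
    most two repairs.\<close>
  proof (rule repair_cycle[of Q0 h Y \<Phi> g 8 E])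
    show "distinct Q0" "set Q0 \<subseteq> V" using uv Q x by (auto simp: Q0_def)
    show "2 * h < length Q0" using Q(3) uv(1) by (simp add: Q0_def)
    show "finite Y" using finite_cycle_edges[of Q] by (simp add: Y_def)
    have "inj_on c ((cycle_edges Q - Y) \<union> {{x, p}, {x, q}})"
      using Q(5) cxpq by (auto simp: inj_on_def Y_def)
    then show "inj_on c (cycle_edges Q0 - Y)" by (rule inj_on_subset) (use eQ0 in auto)
    show "card (nbrs \<Phi> v) \<le> g" if "e \<in> Y" "v \<in> e" for e v
    proof -
      have "e \<inter> B = {}" using that(1) uv(4,5) pq by (auto simp: Y_def S_def p_def q_def)
      moreover have "v \<in> V" using that Q(2) cycle_edges_subset[OF ne, of e] by (auto simp: Y_def)
      ultimately show ?thesis using that(2) by (auto simp: B_def not_less)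
    qed
    have "card (c ` cycle_edges Q0 - \<Phi>) \<le> card {c {x, p}, c {x, q}}"
      using eQ0 by (intro card_mono) (auto simp: \<Phi>_def)
    also have "\<dots> \<le> 2" by (simp add: card_insert_if)
    finally show "card (c ` cycle_edges Q0 - \<Phi>) + 3 * card Y \<le> 8" using cardY by simp
  qed (use Q E hE in auto)
  moreover have "set Q0 = insert x (set Q)" using uv by (auto simp: Q0_def)
  ultimately show ?thesis by simp
qed

lemma rainbow_path_exists:
  assumes "2 * p \<le> card V" "0 < p"
  shows "\<exists>xs. distinct xs \<and> set xs \<subseteq> V \<and> length xs = p \<and> inj_on c (path_edges xs)"
  using assms
proof (induction p)
  case (Suc p)
  show ?case
  proof (cases "p = 0")
    case True
    obtain v where "v \<in> V" using Suc.prems by fastforce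
    then show ?thesis using True by (intro exI[of _ "[v]"]) auto
  next
    case False
    then obtain xs where xs: "distinct xs" "set xs \<subseteq> V" "length xs = p" "inj_on c (path_edges xs)"
      using Suc by auto
    have ne: "xs \<noteq> []" using xs False by auto
    let ?N = "nbrs (c ` path_edges xs) (last xs)"
    have lV: "last xs \<in> V" using xs ne by auto
    have "card ?N \<le> card (c ` path_edges xs)"
      using lV by (intro card_neighbours_le) (auto simp: finite_path_edges)
    also have "\<dots> \<le> card (path_edges xs)" by (intro card_image_le finite_path_edges)
    also have "\<dots> \<le> p - 1" using card_path_edges_le[of xs] xs by simp
    finally have "card (set xs \<union> ?N) \<le> p + (p - 1)"
      using card_Un_le[of "set xs" ?N] xs distinct_card[of xs] by linarith
    also have "p + (p - 1) < card V" using Suc.prems by simp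
    finally have "card (set xs \<union> ?N) < card V" .
    then have "set xs \<union> ?N \<noteq> V" by auto
    then obtain w where w: "w \<in> V" "w \<notin> set xs" "w \<notin> ?N" using xs by auto
    have "w \<noteq> last xs" using w ne by auto
    then have "c {last xs, w} \<notin> c ` path_edges xs" using w by auto
    moreover have "path_edges (xs @ [w]) = insert {last xs, w} (path_edges xs)"
      using ne by (simp add: path_edges_append)
    ultimately have "inj_on c (path_edges (xs @ [w]))"
      using xs(4) unfolding inj_on_insert by auto
    then show ?thesis using xs w by (intro exI[of _ "xs @ [w]"]) auto
  qed
qed simp

text \<open>A greedy path on \<open>p\<close> vertices is closed through a vertex outside it. Its p
  - 1 colours exclude at most p - 1 choices at each end, and p + 2 * (p - 1) is below card
  V.\<close>

lemma rainbow_cycle_exists: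
  assumes "3 * p < card V" "2 \<le> p"
  shows "\<exists>xs. distinct xs \<and> set xs \<subseteq> V \<and> length xs = Suc p \<and> inj_on c (cycle_edges xs)"
proof -
  obtain xs where xs: "distinct xs" "set xs \<subseteq> V" "length xs = p" "inj_on c (path_edges xs)"
    using rainbow_path_exists[of p] assms by auto
  have ne: "xs \<noteq> []" using xs assms by auto
  let ?M = "nbrs (c ` path_edges xs) (hd xs)" and ?N = "nbrs (c ` path_edges xs) (last xs)"
  have V: "last xs \<in> V" "hd xs \<in> V" using xs ne by auto
  have "card (nbrs (c ` path_edges xs) v) \<le> p - 1" if "v \<in> V" for v
  proof -
    have "card (nbrs (c ` path_edges xs) v) \<le> card (c ` path_edges xs)"
      using that by (intro card_neighbours_le) (auto simp: finite_path_edges)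
    also have "\<dots> \<le> card (path_edges xs)" by (intro card_image_le finite_path_edges)
    also have "\<dots> \<le> p - 1" using card_path_edges_le[of xs] xs by simp
    finally show ?thesis .
  qed
  then have "card ?N \<le> p - 1" "card ?M \<le> p - 1" using V by blast+
  moreover have "card (set xs) = p" using xs distinct_card by blast
  moreover have "card (set xs \<union> ?N \<union> ?M) \<le> card (set xs) + card ?N + card ?M"
    using card_Un_le[of "set xs \<union> ?N" ?M] card_Un_le[of "set xs" ?N] by linarith
  ultimately have "card (set xs \<union> ?N \<union> ?M) \<le> p + (p - 1) + (p - 1)" by linarith
  also have "p + (p - 1) + (p - 1) < card V" using assms by simp
  finally have "card (set xs \<union> ?N \<union> ?M) < card V" .
  then have "set xs \<union> ?N \<union> ?M \<noteq> V" by auto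
  then obtain w where w: "w \<in> V" "w \<notin> set xs" "w \<notin> ?N" "w \<notin> ?M" using xs by auto
  have wn: "w \<noteq> last xs" "w \<noteq> hd xs" using w ne by auto
  have "hd xs \<noteq> last xs"
  proof -
    obtain y z zs where "xs = y # z # zs" using xs assms by (cases xs; cases "tl xs") auto
    then show ?thesis using xs(1) last_in_set[of "z # zs"] by auto
  qed
  then have "c {w, last xs} \<noteq> c {w, hd xs}" using proper[of w "last xs" "hd xs"] w wn V by auto
  moreover have "c {w, last xs} \<notin> c ` path_edges xs" "c {w, hd xs} \<notin> c ` path_edges xs"
    using w wn by (auto simp: insert_commute)
  moreover have "cycle_edges (xs @ [w]) = insert {w, last xs} (insert {w, hd xs} (path_edges xs))"
    using ne by (simp add: cycle_edges_append insert_commute)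
  ultimately have "inj_on c (cycle_edges (xs @ [w]))"
    using xs(4) unfolding inj_on_insert by auto
  then show ?thesis using xs w by (intro exI[of _ "xs @ [w]"]) auto
qed

theorem rainbow_hamilton_cycle:
  assumes t: "100 \<le> t" "900 * t \<le> card V"
    and E: "\<And>\<Psi>. finite \<Psi> \<Longrightarrow> card \<Psi> \<le> card V \<Longrightarrow> card (coloured_pairs \<Psi>) \<le> 410 * t * t"
  shows "\<exists>Q. distinct Q \<and> set Q = V \<and> inj_on c (cycle_edges Q)"
proof -
  \<comment> \<open>The length 225 * t is small enough for the greedy start, 3 * 225 * t < 900 * t,
    and large enough for the extension lemma.\<close>
  define good where "good Q \<longleftrightarrow> distinct Q \<and> set Q \<subseteq> V \<and> 225 * t \<le> length Q \<and>
    inj_on c (cycle_edges Q)" for Q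
  have "3 * (225 * t) < card V" "2 \<le> 225 * t" using t by simp_all
  from rainbow_cycle_exists[OF this] obtain Q0 where "good Q0" unfolding good_def by fastforce
  moreover have "\<forall>Q. good Q \<longrightarrow> length Q < Suc (card V)"
  proof (intro allI impI)
    fix Q assume "good Q"
    then have "length Q = card (set Q)" "set Q \<subseteq> V" by (simp_all add: good_def distinct_card)
    then show "length Q < Suc (card V)" using card_mono[OF finite_V] by (simp add: less_Suc_eq_le)
  qed
  ultimately obtain Q where Q: "good Q" and maxi: "\<And>Q'. good Q' \<Longrightarrow> length Q' \<le> length Q"
    using ex_has_greatest_nat[of good Q0 length] by blast
  have "set Q = V"
  proof (rule ccontr)
    assume "set Q \<noteq> V"
    then obtain x where x: "x \<in> V" "x \<notin> set Q" using Q by (auto simp: good_def)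
    have "\<exists>Q'. distinct Q' \<and> set Q' = insert x (set Q) \<and> inj_on c (cycle_edges Q')"
    \<comment> \<open>With h = 100 * t and g = 9 * t the bad choices number about 2210 * t * t out
      of 10000 * t * t, and at most 410 * t / 9 vertices have high degree; four times this is about
      182 * t < 225 * t.\<close>
    proof (rule extend_rainbow_cycle[of Q "100 * t" x "410 * t * t" "9 * t"])
      have "100 * t \<le> t * t" using t by simp
      then show "(2 * (9 * t + 8) + 3) * (100 * t) + 410 * t * t < 100 * t * (100 * t)"
        using t by (simp add: algebra_simps)
      show "4 * b + 1 < length Q" if b: "b * Suc (9 * t) \<le> 410 * t * t" for b
      proof -
        have "(9 * b) * t \<le> b * Suc (9 * t)" by simp
        also have "\<dots> \<le> (410 * t) * t" by (rule b)
        finally have "9 * b \<le> 410 * t" using t by simp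
        then show ?thesis using Q t by (simp add: good_def)
      qed
    qed (use Q x t E in \<open>auto simp: good_def\<close>)
    then obtain Q' where Q': "distinct Q'" "set Q' = insert x (set Q)" "inj_on c (cycle_edges Q')"
      by blast
    have "length Q' = Suc (length Q)"
      using Q' Q x distinct_card[of Q'] distinct_card[of Q] by (simp add: good_def)
    moreover from this have "good Q'" using Q Q' x by (auto simp: good_def)
    ultimately show False using maxi by fastforce
  qed
  then show ?thesis using Q by (auto simp: good_def)
qed

end

subsection \<open>Reserved colours\<close>

text \<open>A function that is affine in each variable takes at some 0/1 point at most its value at a given
  point of the cube. This replaces a random set of colours of density \<open>\<eta>\<close>: the function is the
  expected number of failures, with exponential moments bounding the tails.\<close>

definition multi_affine :: "(('c \<Rightarrow> real) \<Rightarrow> real) \<Rightarrow> bool" where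
  "multi_affine f \<longleftrightarrow> (\<forall>x a. f x = (1 - x a) * f (x(a := 0)) + x a * f (x(a := 1)))"

lemma multi_affineD: "multi_affine f \<Longrightarrow> f x = (1 - x a) * f (x(a := 0)) + x a * f (x(a := 1))"
  by (simp add: multi_affine_def)

text \<open>Method of conditional expectations: in one coordinate the value is a convex combination
  of those at 0 and 1, one of which is no larger. Coordinates are rounded in turn.\<close>

lemma multi_affine_rounding:
  assumes "multi_affine f" "finite S" "\<And>a. a \<in> S \<Longrightarrow> 0 \<le> x a \<and> x a \<le> 1"
  shows "\<exists>K\<subseteq>S. f (\<lambda>a. if a \<in> S then of_bool (a \<in> K) else x a) \<le> f x"
  using assms(2,3)
proof (induction S arbitrary: x rule: finite_induct)
  case (insert a S)
  have "\<exists>b\<in>{0, 1}. f (x(a := b)) \<le> f x"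
  proof (rule ccontr)
    assume "\<not> ?thesis"
    then have *: "f x < f (x(a := 0))" "f x < f (x(a := 1))" by auto
    have "(1 - x a) * f x + x a * f x < (1 - x a) * f (x(a := 0)) + x a * f (x(a := 1))"
    proof (cases "x a = 0")
      case False
      then have "x a * f x < x a * f (x(a := 1))" using * insert.prems[of a] by simp
      moreover have "(1 - x a) * f x \<le> (1 - x a) * f (x(a := 0))"
        using * insert.prems[of a] by (intro mult_left_mono) auto
      ultimately show ?thesis by linarith
    qed (use * in simp)
    moreover have "(1 - x a) * f x + x a * f x = f x" by (simp add: algebra_simps)
    ultimately show False using multi_affineD[OF assms(1), of x a] by simp
  qed
  then obtain b where b: "b = 0 \<or> b = 1" "f (x(a := b)) \<le> f x" by auto
  have "0 \<le> (x(a := b)) d \<and> (x(a := b)) d \<le> 1" if "d \<in> S" for d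
    using insert.prems[of d] that b(1) by auto
  then have "\<exists>K\<subseteq>S. f (\<lambda>d. if d \<in> S then of_bool (d \<in> K) else (x(a := b)) d) \<le> f (x(a := b))"
    by (rule insert.IH)
  then obtain K where K: "K \<subseteq> S"
    "f (\<lambda>d. if d \<in> S then of_bool (d \<in> K) else (x(a := b)) d) \<le> f (x(a := b))" by auto
  let ?K = "if b = 1 then insert a K else K"
  have "(\<lambda>d. if d \<in> insert a S then of_bool (d \<in> ?K) else x d) =
      (\<lambda>d. if d \<in> S then of_bool (d \<in> K) else (x(a := b)) d)"
    using b(1) K(1) insert.hyps(2) by (auto simp: fun_eq_iff)
  then show ?case using K b(2) by (intro exI[of _ ?K]) auto
qed auto

lemma multi_affine_sum:
  assumes "\<And>i. i \<in> I \<Longrightarrow> multi_affine (f i)"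
  shows "multi_affine (\<lambda>x. \<Sum>i\<in>I. f i x)"
  unfolding multi_affine_def
proof (intro allI)
  fix x a
  have "(\<Sum>i\<in>I. f i x) = (\<Sum>i\<in>I. (1 - x a) * f i (x(a := 0)) + x a * f i (x(a := 1)))"
    by (intro sum.cong refl multi_affineD assms)
  then show "(\<Sum>i\<in>I. f i x) =
      (1 - x a) * (\<Sum>i\<in>I. f i (x(a := 0))) + x a * (\<Sum>i\<in>I. f i (x(a := 1)))"
    by (simp add: sum.distrib sum_distrib_left)
qed

lemma multi_affine_add: "multi_affine f \<Longrightarrow> multi_affine g \<Longrightarrow> multi_affine (\<lambda>x. f x + g x)"
  unfolding multi_affine_def
proof (intro allI)
  fix x a
  assume f: "\<forall>x a. f x = (1 - x a) * f (x(a := 0)) + x a * f (x(a := 1))"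
    and g: "\<forall>x a. g x = (1 - x a) * g (x(a := 0)) + x a * g (x(a := 1))"
  show "f x + g x = (1 - x a) * (f (x(a := 0)) + g (x(a := 0))) + x a * (f (x(a := 1)) + g (x(a := 1)))"
    using spec[OF spec[OF f, of x], of a] spec[OF spec[OF g, of x], of a]
    by (simp add: algebra_simps)
qed

lemma multi_affine_cmult: "multi_affine f \<Longrightarrow> multi_affine (\<lambda>x. r * f x)"
  unfolding multi_affine_def
proof (intro allI)
  fix x a
  assume f: "\<forall>x a. f x = (1 - x a) * f (x(a := 0)) + x a * f (x(a := 1))"
  show "r * f x = (1 - x a) * (r * f (x(a := 0))) + x a * (r * f (x(a := 1)))"
    by (subst spec[OF spec[OF f, of x], of a]) (simp add: algebra_simps)
qed

text \<open>\<open>S i\<close> contains all variables on which factor \<open>i\<close> depends. By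
  disjointness a single variable touches at most one factor.\<close>

lemma multi_affine_prod:
  assumes I: "finite I" and f: "\<And>i. i \<in> I \<Longrightarrow> multi_affine (f i)"
    and S: "\<And>i x a b. i \<in> I \<Longrightarrow> a \<notin> S i \<Longrightarrow> f i (x(a := b)) = f i x"
    and disj: "\<And>i j. i \<in> I \<Longrightarrow> j \<in> I \<Longrightarrow> i \<noteq> j \<Longrightarrow> S i \<inter> S j = {}"
  shows "multi_affine (\<lambda>x. \<Prod>i\<in>I. f i x)"
  unfolding multi_affine_def
proof (intro allI)
  fix x a
  show "(\<Prod>i\<in>I. f i x) =
      (1 - x a) * (\<Prod>i\<in>I. f i (x(a := 0))) + x a * (\<Prod>i\<in>I. f i (x(a := 1)))"
  proof (cases "\<exists>i\<in>I. a \<in> S i")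
    case True
    then obtain i where i: "i \<in> I" "a \<in> S i" by blast
    have eq: "(\<Prod>j\<in>I - {i}. f j (x(a := b))) = (\<Prod>j\<in>I - {i}. f j x)" for b
      using disj i by (intro prod.cong S refl) auto
    show ?thesis
      unfolding prod.remove[OF I i(1)] eq
      by (subst multi_affineD[OF f[OF i(1)], of x a]) (simp add: algebra_simps)
  next
    case False
    then have eq: "(\<Prod>j\<in>I. f j (x(a := b))) = (\<Prod>j\<in>I. f j x)" for b
      by (intro prod.cong S refl) auto
    show ?thesis unfolding eq by (simp add: algebra_simps)
  qed
qed

context proper_colouring
begin

text \<open>A maximal such \<open>Z\<close> works: each of its elements conflicts with itself and at
  most two others, the vertices where its two colours recur with \<open>u\<close> and
  \<open>v\<close> exchanged. Disjoint colour sets play the part of independence in the product over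
  \<open>Z\<close>.\<close>

lemma colour_disjoint_vertices:
  assumes uv: "u \<in> V" "v \<in> V" and R: "R \<subseteq> V - {u, v}"
  obtains Z where "Z \<subseteq> R" "card R \<le> 3 * card Z"
    "\<And>y z. y \<in> Z \<Longrightarrow> z \<in> Z \<Longrightarrow> y \<noteq> z \<Longrightarrow> {c {u, y}, c {v, y}} \<inter> {c {u, z}, c {v, z}} = {}"
proof -
  let ?S = "\<lambda>z. {c {u, z}, c {v, z}}"
  define ok where "ok Z \<longleftrightarrow> Z \<subseteq> R \<and> (\<forall>y\<in>Z. \<forall>z\<in>Z. y \<noteq> z \<longrightarrow> ?S y \<inter> ?S z = {})" for Z
  have finR: "finite R" using R finite_V by (meson finite_Diff finite_subset)
  have "ok {}" by (simp add: ok_def)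
  moreover have "\<forall>Z. ok Z \<longrightarrow> card Z < Suc (card R)"
    using card_mono[OF finR] by (auto simp: ok_def less_Suc_eq_le)
  ultimately obtain Z where Z: "ok Z" and maxi: "\<And>Z'. ok Z' \<Longrightarrow> card Z' \<le> card Z"
    using ex_has_greatest_nat[of ok "{}" card] by blast
  have finZ: "finite Z" using Z finR finite_subset by (auto simp: ok_def)
  have "R \<subseteq> (\<Union>y\<in>Z. {z \<in> R. ?S y \<inter> ?S z \<noteq> {}})"
  proof
    fix z assume z: "z \<in> R"
    show "z \<in> (\<Union>y\<in>Z. {z \<in> R. ?S y \<inter> ?S z \<noteq> {}})"
    proof (cases "z \<in> Z")
      case False
      then have "\<not> ok (insert z Z)" using maxi[of "insert z Z"] finZ by auto
      then show ?thesis using Z z False unfolding ok_def by blast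
    qed (use z in auto)
  qed
  then have "card R \<le> card (\<Union>y\<in>Z. {z \<in> R. ?S y \<inter> ?S z \<noteq> {}})"
    using finR finZ by (intro card_mono) auto
  also have "\<dots> \<le> (\<Sum>y\<in>Z. card {z \<in> R. ?S y \<inter> ?S z \<noteq> {}})" by (rule card_UN_le[OF finZ])
  also have "\<dots> \<le> (\<Sum>y\<in>Z. 3)"
  proof (rule sum_mono)
    fix y assume y: "y \<in> Z"
    then have yR: "y \<in> R" using Z by (auto simp: ok_def)
    let ?A = "{z \<in> R. c {u, z} = c {v, y}}" and ?B = "{z \<in> R. c {v, z} = c {u, y}}"
    have "{z \<in> R. ?S y \<inter> ?S z \<noteq> {}} \<subseteq> insert y (?A \<union> ?B)"
    proof
      fix z assume "z \<in> {z \<in> R. ?S y \<inter> ?S z \<noteq> {}}"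
      then have z: "z \<in> R" "c {u, z} = c {u, y} \<or> c {v, z} = c {v, y} \<or> c {u, z} = c {v, y} \<or>
        c {v, z} = c {u, y}" by auto
      have "z = y" if "c {u, z} = c {u, y}" using proper[of u z y] z yR R uv that by blast
      moreover have "z = y" if "c {v, z} = c {v, y}" using proper[of v z y] z yR R uv that by blast
      ultimately show "z \<in> insert y (?A \<union> ?B)" using z by auto
    qed
    then have "card {z \<in> R. ?S y \<inter> ?S z \<noteq> {}} \<le> card (insert y (?A \<union> ?B))"
      using finR by (intro card_mono) auto
    also have "\<dots> \<le> Suc (card (?A \<union> ?B))" by (rule card_insert_le_m1) auto
    also have "card (?A \<union> ?B) \<le> card ?A + card ?B" by (rule card_Un_le)
    also have "card ?A \<le> card {c {v, y}}" using R uv by (intro card_neighbours_le[of u]) auto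
    also have "card ?B \<le> card {c {u, y}}" using R uv by (intro card_neighbours_le[of v]) auto
    finally show "card {z \<in> R. ?S y \<inter> ?S z \<noteq> {}} \<le> 3" by simp
  qed
  finally have "card R \<le> 3 * card Z" by simp
  then show thesis using that[of Z] Z by (auto simp: ok_def)
qed

text \<open>At a 0/1 point \<open>f u v\<close> is 2^-k for the number k of good vertices in
  \<open>Z u v\<close>, and \<open>g v\<close> is 2^d for the reserved degree d of \<open>v\<close>.
  Since all summands of \<open>F\<close> are nonnegative, F < 1 forces k > N for every pair and d <
  T for every vertex. The hypothesis \<open>small\<close> bounds \<open>F\<close> at the constant
  point \<eta>.\<close>

theorem reserved_colours:
  assumes R: "R \<subseteq> V" and m: "3 * m + 2 \<le> card R" and \<eta>: "0 \<le> \<eta>" "\<eta> \<le> 1"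
    and small: "real (card V)^2 * (2^N * (1 - \<eta> * \<eta> / 2)^m) + card V * ((1 + \<eta>)^card V / 2^T) < 1"
  obtains K where "\<And>v. v \<in> V \<Longrightarrow> card {w \<in> V - {v}. c {v, w} \<in> K} \<le> T"
    "\<And>u v. u \<in> V \<Longrightarrow> v \<in> V \<Longrightarrow> u \<noteq> v \<Longrightarrow>
      N < card {z \<in> R - {u, v}. c {u, z} \<in> K \<and> c {v, z} \<in> K}"
proof -
  define prs where "prs = {(u, v). u \<in> V \<and> v \<in> V \<and> u \<noteq> v}"
  have prsV: "prs \<subseteq> V \<times> V" by (auto simp: prs_def)
  then have finp: "finite prs" using finite_V finite_subset by blast
  have "\<forall>u v. \<exists>Z. u \<in> V \<and> v \<in> V \<longrightarrow> Z \<subseteq> R - {u, v} \<and> card (R - {u, v}) \<le> 3 * card Z \<and>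
    (\<forall>y\<in>Z. \<forall>z\<in>Z. y \<noteq> z \<longrightarrow> {c {u, y}, c {v, y}} \<inter> {c {u, z}, c {v, z}} = {})"
  proof (intro allI)
    fix u v
    show "\<exists>Z. u \<in> V \<and> v \<in> V \<longrightarrow> Z \<subseteq> R - {u, v} \<and> card (R - {u, v}) \<le> 3 * card Z \<and>
      (\<forall>y\<in>Z. \<forall>z\<in>Z. y \<noteq> z \<longrightarrow> {c {u, y}, c {v, y}} \<inter> {c {u, z}, c {v, z}} = {})"
    proof (cases "u \<in> V \<and> v \<in> V")
      case True
      then have "u \<in> V" "v \<in> V" "R - {u, v} \<subseteq> V - {u, v}" using R by auto
      from colour_disjoint_vertices[OF this] show ?thesis by metis
    qed auto
  qed
  then obtain Z where Z: "\<And>u v. u \<in> V \<Longrightarrow> v \<in> V \<Longrightarrow> Z u v \<subseteq> R - {u, v} \<and>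
      card (R - {u, v}) \<le> 3 * card (Z u v) \<and>
      (\<forall>y\<in>Z u v. \<forall>z\<in>Z u v. y \<noteq> z \<longrightarrow> {c {u, y}, c {v, y}} \<inter> {c {u, z}, c {v, z}} = {})"
    by metis
  have finR: "finite R" using R finite_V finite_subset by blast
  have finZ: "finite (Z u v)" if "u \<in> V" "v \<in> V" for u v
    using Z[OF that] finR by (meson finite_Diff finite_subset)
  have ZV: "z \<in> V" "z \<noteq> u" "z \<noteq> v" "z \<in> R" if "z \<in> Z u v" "u \<in> V" "v \<in> V" for u v z
    using Z[OF that(2,3)] that(1) R by auto
  \<comment> \<open>The 2 in the bound on \<open>card R\<close> pays for removing \<open>u\<close>
    and \<open>v\<close>, the 3 for passing to disjoint colour sets.\<close>
  have cZ: "m \<le> card (Z u v)" if "u \<in> V" "v \<in> V" for u v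
  proof -
    have "card R - card {u, v} \<le> card (R - {u, v})" by (rule diff_card_le_card_Diff) simp
    moreover have "card {u, v} \<le> 2" by (simp add: card_insert_if)
    ultimately show ?thesis using m Z[OF that] by linarith
  qed
  define f where "f u v x = (\<Prod>z\<in>Z u v. 1 - x (c {u, z}) * x (c {v, z}) / 2)" for u v and x :: "'c \<Rightarrow> real"
  define g where "g v x = (\<Prod>w\<in>V - {v}. 1 + x (c {v, w}))" for v and x :: "'c \<Rightarrow> real"
  define F where "F x = (\<Sum>p\<in>prs. 2^N * f (fst p) (snd p) x) + (\<Sum>v\<in>V. 1 / 2^T * g v x)"
    for x :: "'c \<Rightarrow> real"
  \<comment> \<open>Distinct colours keep squares of a variable out of the factors of
    \<open>f\<close>, which would not be affine.\<close>
  have diff: "c {u, z} \<noteq> c {v, z}" if "u \<in> V" "v \<in> V" "u \<noteq> v" "z \<in> Z u v" for u v z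
    using proper[of z u v] ZV[OF that(4,1,2)] that by (auto simp: insert_commute)
  have "multi_affine (f u v)" if uv: "u \<in> V" "v \<in> V" "u \<noteq> v" for u v
    unfolding f_def
  proof (rule multi_affine_prod[where S = "\<lambda>z. {c {u, z}, c {v, z}}"])
    show "multi_affine (\<lambda>x. 1 - x (c {u, z}) * x (c {v, z}) / 2)" if "z \<in> Z u v" for z
      using diff[OF uv that] unfolding multi_affine_def by (auto simp: field_simps)
  qed (use finZ Z uv in auto)
  moreover have "multi_affine (g v)" if v: "v \<in> V" for v
    unfolding g_def
  proof (rule multi_affine_prod[where S = "\<lambda>w. {c {v, w}}"])
    show "multi_affine (\<lambda>x. 1 + x (c {v, w}))" for w
      unfolding multi_affine_def by (auto simp: field_simps)
    show "{c {v, y}} \<inter> {c {v, z}} = {}" if "y \<in> V - {v}" "z \<in> V - {v}" "y \<noteq> z" for y z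
      using proper[of v y z] that v by auto
  qed (use finite_V in auto)
  ultimately have aff: "multi_affine F" unfolding F_def
    by (intro multi_affine_add multi_affine_sum multi_affine_cmult) (auto simp: prs_def)
  \<comment> \<open>The colour type may be infinite; rounding is confined to the finitely many
    colours on which \<open>F\<close> depends.\<close>
  define Col where "Col = (\<lambda>(u, v). c {u, v}) ` (V \<times> V)"
  have finCol: "finite Col" using finite_V by (simp add: Col_def)
  have Col: "c {u, v} \<in> Col" if "u \<in> V" "v \<in> V" for u v using that by (auto simp: Col_def)
  obtain K where K: "K \<subseteq> Col"
    "F (\<lambda>a. if a \<in> Col then of_bool (a \<in> K) else \<eta>) \<le> F (\<lambda>_. \<eta>)"
    using multi_affine_rounding[OF aff finCol, of "\<lambda>_. \<eta>"] \<eta> by auto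
  define \<chi> :: "'c \<Rightarrow> real" where "\<chi> = (\<lambda>a. if a \<in> Col then of_bool (a \<in> K) else \<eta>)"
  have \<chi>: "\<chi> (c {u, v}) = of_bool (c {u, v} \<in> K)" if "u \<in> V" "v \<in> V" for u v
    using Col[OF that] by (simp add: \<chi>_def)
  have q: "0 \<le> 1 - \<eta> * \<eta> / 2" "1 - \<eta> * \<eta> / 2 \<le> 1" using \<eta> mult_le_one[of \<eta> \<eta>] by auto
  have "F (\<lambda>_. \<eta>) \<le> (\<Sum>p\<in>prs. 2^N * (1 - \<eta> * \<eta> / 2)^m) + (\<Sum>v\<in>V. 1 / 2^T * (1 + \<eta>)^card V)"
    unfolding F_def
  proof (intro add_mono sum_mono mult_left_mono)
    show "f (fst p) (snd p) (\<lambda>_. \<eta>) \<le> (1 - \<eta> * \<eta> / 2)^m" if "p \<in> prs" for p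
      using cZ[of "fst p" "snd p"] that q unfolding f_def prod_constant
      by (intro power_decreasing) (auto simp: prs_def)
    show "g v (\<lambda>_. \<eta>) \<le> (1 + \<eta>)^card V" for v
      using \<eta> card_mono[OF finite_V, of "V - {v}"] unfolding g_def prod_constant
      by (intro power_increasing) auto
  qed auto
  also have "\<dots> = card prs * (2^N * (1 - \<eta> * \<eta> / 2)^m) + card V * ((1 + \<eta>)^card V / 2^T)" by simp
  also have "real (card prs) \<le> real (card V)^2"
  proof -
    have "card prs \<le> card (V \<times> V)" using prsV finite_V by (intro card_mono) auto
    then show ?thesis by (simp add: card_cartesian_product power2_eq_square flip: of_nat_mult)
  qed
  finally have "F (\<lambda>_. \<eta>) \<le> real (card V)^2 * (2^N * (1 - \<eta> * \<eta> / 2)^m) + card V * ((1 + \<eta>)^card V / 2^T)"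
    using q by (simp add: mult_right_mono)
  then have F1: "F \<chi> < 1" using K(2) small by (simp add: \<chi>_def)
  have f\<chi>: "f u v \<chi> = (1 / 2)^card {z \<in> Z u v. c {u, z} \<in> K \<and> c {v, z} \<in> K}"
    if uv: "u \<in> V" "v \<in> V" for u v
  proof -
    have "f u v \<chi> = (\<Prod>z\<in>Z u v. if c {u, z} \<in> K \<and> c {v, z} \<in> K then 1 / 2 else 1)"
      unfolding f_def using ZV uv \<chi> by (intro prod.cong) auto
    also have "\<dots> = (\<Prod>z\<in>{z \<in> Z u v. c {u, z} \<in> K \<and> c {v, z} \<in> K}. 1 / 2)"
      using finZ[OF uv] by (intro prod.inter_filter[symmetric])
    finally show ?thesis by simp
  qed
  have g\<chi>: "g v \<chi> = 2^card {w \<in> V - {v}. c {v, w} \<in> K}" if v: "v \<in> V" for v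
  proof -
    have "g v \<chi> = (\<Prod>w\<in>V - {v}. if c {v, w} \<in> K then 2 else 1)"
      unfolding g_def using v \<chi> by (intro prod.cong) auto
    also have "\<dots> = (\<Prod>w\<in>{w \<in> V - {v}. c {v, w} \<in> K}. 2)"
      using finite_V by (intro prod.inter_filter[symmetric]) auto
    finally show ?thesis by simp
  qed
  have f0: "0 \<le> f (fst p) (snd p) \<chi>" if "p \<in> prs" for p using that f\<chi> by (auto simp: prs_def)
  have g0: "0 \<le> g v \<chi>" if "v \<in> V" for v using that g\<chi> by auto
  show thesis
  proof (rule that[of K])
    fix v assume v: "v \<in> V"
    have "1 / 2^T * g v \<chi> \<le> (\<Sum>v\<in>V. 1 / 2^T * g v \<chi>)"
      using finite_V g0 v by (intro member_le_sum) auto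
    also have "\<dots> \<le> F \<chi>" unfolding F_def using f0 by (auto intro!: sum_nonneg)
    also note F1
    finally have "g v \<chi> < 2^T" by (simp add: divide_less_eq)
    then show "card {w \<in> V - {v}. c {v, w} \<in> K} \<le> T" using g\<chi>[OF v] by simp
  next
    fix u v assume uv: "u \<in> V" "v \<in> V" "u \<noteq> v"
    let ?k = "card {z \<in> Z u v. c {u, z} \<in> K \<and> c {v, z} \<in> K}"
    have "2^N * f u v \<chi> \<le> (\<Sum>p\<in>prs. 2^N * f (fst p) (snd p) \<chi>)"
      using finp f0 uv member_le_sum[of "(u, v)" prs "\<lambda>p. 2^N * f (fst p) (snd p) \<chi>"]
      by (auto simp: prs_def)
    also have "\<dots> \<le> F \<chi>" unfolding F_def using g0 by (auto intro!: sum_nonneg)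
    finally have "2^N * (1 / 2)^?k < (1::real)" using F1 f\<chi>[OF uv(1,2)] by simp
    then have "(2::real)^N < 2^?k" by (simp add: field_simps power_divide)
    then have "N < ?k" by simp
    also have "?k \<le> card {z \<in> R - {u, v}. c {u, z} \<in> K \<and> c {v, z} \<in> K}"
      using finR ZV[OF _ uv(1,2)] by (intro card_mono) auto
    finally show "N < card {z \<in> R - {u, v}. c {u, z} \<in> K \<and> c {v, z} \<in> K}" .
  qed
qed

end

subsection \<open>Sparse vertex sets and linking\<close>

context proper_colouring
begin

text \<open>Each pair of disjoint edges of equal colour inside \<open>R\<close> is counted eight
  times.\<close>

definition repeats :: "'a set \<Rightarrow> 'a list set" where
  "repeats R = {q. length q = 4 \<and> distinct q \<and> set q \<subseteq> R \<and> c {q ! 0, q ! 1} = c {q ! 2, q ! 3}}"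

lemma finite_repeats: "R \<subseteq> V \<Longrightarrow> finite (repeats R)"
  by (rule finite_subset[OF _ finite_lists_length_eq[of R 4]])
    (auto simp: repeats_def dest: finite_subset[OF _ finite_V])

text \<open>The first three entries and properness determine the fourth.\<close>

lemma card_repeats_le: "card (repeats V) \<le> card V ^ 3"
proof -
  have "card (repeats V) \<le> card {q. set q \<subseteq> V \<and> length q = 3}"
  proof (rule card_inj_on_le[of "take 3"])
    show "inj_on (take 3) (repeats V)"
    proof (rule inj_onI)
      fix p q assume p: "p \<in> repeats V" and q: "q \<in> repeats V" and eq: "take 3 p = take 3 q"
      obtain p0 p1 p2 p3 where p': "p = [p0, p1, p2, p3]"
        using p by (auto simp: repeats_def numeral_eq_Suc length_Suc_conv)
      obtain q0 q1 q2 q3 where q': "q = [q0, q1, q2, q3]"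
        using q by (auto simp: repeats_def numeral_eq_Suc length_Suc_conv)
      have *: "p0 = q0" "p1 = q1" "p2 = q2" using eq by (auto simp: p' q' numeral_eq_Suc)
      have "c {p2, p3} = c {p2, q3}"
        using p q by (auto simp: repeats_def p' q' * numeral_eq_Suc)
      then have "p3 = q3" using proper[of p2 p3 q3] p q by (auto simp: repeats_def p' q' *)
      then show "p = q" by (simp add: p' q' *)
    qed
    show "take 3 ` repeats V \<subseteq> {q. set q \<subseteq> V \<and> length q = 3}"
      by (auto simp: repeats_def dest: in_set_takeD)
  qed (simp add: finite_lists_length_eq finite_V)
  then show ?thesis using card_lists_length_eq[OF finite_V, of 3] by simp
qed

text \<open>Averaging over \<open>v\<close>: each list in \<open>repeats R\<close> survives the deletion of \<open>card R - 4\<close> of the vertices.\<close>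

lemma remove_vertex:
  assumes R: "R \<subseteq> V" "R \<noteq> {}"
  shows "\<exists>v\<in>R. card R * card (repeats (R - {v})) \<le> (card R - 4) * card (repeats R)"
proof (rule ccontr)
  assume "\<not> ?thesis"
  then have *: "(card R - 4) * card (repeats R) < card R * card (repeats (R - {v}))" if "v \<in> R" for v
    using that by force
  have fin: "finite R" "finite (repeats R)"
    using R finite_V finite_subset finite_repeats by blast+
  have "card R * ((card R - 4) * card (repeats R)) = (\<Sum>v\<in>R. (card R - 4) * card (repeats R))"
    by simp
  also have "\<dots> < (\<Sum>v\<in>R. card R * card (repeats (R - {v})))"
    using fin R * by (intro sum_strict_mono) auto
  also have "\<dots> = card R * (\<Sum>v\<in>R. card (repeats (R - {v})))" by (simp add: sum_distrib_left)
  also have "(\<Sum>v\<in>R. card (repeats (R - {v}))) = (\<Sum>v\<in>R. card {q \<in> repeats R. v \<notin> set q})"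
    by (intro sum.cong refl arg_cong[where f = card]) (auto simp: repeats_def)
  also have "\<dots> = card (SIGMA v:R. {q \<in> repeats R. v \<notin> set q})"
    using fin by (intro card_SigmaI[symmetric]) auto
  also have "\<dots> = card (SIGMA q:repeats R. R - set q)"
    by (rule bij_betw_same_card[of prod.swap]) (auto simp: bij_betw_def inj_on_def image_iff)
  also have "\<dots> = (\<Sum>q\<in>repeats R. card (R - set q))"
    using fin by (intro card_SigmaI) auto
  also have "\<dots> = (\<Sum>q\<in>repeats R. card R - 4)"
  proof (rule sum.cong)
    fix q assume "q \<in> repeats R"
    then have "set q \<subseteq> R" "card (set q) = 4" using distinct_card[of q] by (auto simp: repeats_def)
    then show "card (R - set q) = card R - 4" by (simp add: card_Diff_subset)
  qed simp
  finally show False by (simp add: mult_ac)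
qed

text \<open>Suitable deletions never increase the ratio of \<open>card (repeats R)\<close> to
  \<open>card R ^ 4\<close>, so the density of repeats in \<open>V\<close> passes down to size
  \<open>j\<close>.\<close>

lemma sparse_subset:
  assumes "j \<le> card V"
  shows "\<exists>R\<subseteq>V. card R = j \<and> card (repeats R) * card V ^ 4 \<le> card (repeats V) * j ^ 4"
  using assms
proof (induction rule: inc_induct)
  case base
  show ?case by (intro exI[of _ V]) auto
next
  case (step j)
  then obtain R where R: "R \<subseteq> V" "card R = Suc j"
    "card (repeats R) * card V ^ 4 \<le> card (repeats V) * Suc j ^ 4" by blast
  then obtain v where v: "v \<in> R"
    "Suc j * card (repeats (R - {v})) \<le> (Suc j - 4) * card (repeats R)"
    using remove_vertex[of R] by force
  \<comment> \<open>The factor (j - 3) / (j + 1) gained by a deletion is at most (j / (j +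
    1))^4.\<close>
  have poly: "(Suc j - 4) * Suc j ^ 3 \<le> j ^ 4"
  proof (cases "j \<ge> 3")
    case True
    then obtain i where "j = i + 3" by (metis add.commute le_Suc_ex)
    moreover have "(i + 3) ^ 4 = i * (i + 4) ^ 3 + (6 * i ^ 2 + 44 * i + 81)"
      by (simp add: power4_eq_xxxx power3_eq_cube power2_eq_square algebra_simps)
    ultimately show ?thesis by (simp add: add.commute)
  qed simp
  let ?x = "card (repeats (R - {v}))"
  have "Suc j ^ 4 * (?x * card V ^ 4) = Suc j ^ 3 * card V ^ 4 * (Suc j * ?x)"
    using power_Suc[of "Suc j" 3] by (simp only: mult_ac Suc_numeral semiring_norm)
  also have "\<dots> \<le> Suc j ^ 3 * card V ^ 4 * ((Suc j - 4) * card (repeats R))"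
    using v(2) by (rule mult_le_mono2)
  also have "\<dots> = ((Suc j - 4) * Suc j ^ 3) * (card (repeats R) * card V ^ 4)" by (simp only: mult_ac)
  also have "\<dots> \<le> j ^ 4 * (card (repeats V) * Suc j ^ 4)"
    using poly R(3) by (rule mult_le_mono)
  also have "\<dots> = Suc j ^ 4 * (card (repeats V) * j ^ 4)" by (simp only: mult_ac)
  finally have "?x * card V ^ 4 \<le> card (repeats V) * j ^ 4" by (simp del: power_Suc)
  then show ?case using R v(1) finite_V by (intro exI[of _ "R - {v}"]) auto
qed

text \<open>A colour on k ordered pairs yields k * (k - 2) repeats, as only a pair and its reversal
  are excluded as partners. If k > \<tau> + 2 this exceeds \<tau> * k; smaller classes are bounded
  by their size.\<close>

lemma coloured_pairs_le:
  assumes "finite \<Phi>"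
  shows "\<tau> * card (coloured_pairs \<Phi>) \<le> \<tau> * (\<tau> + 2) * card \<Phi> + card (repeats V)"
proof -
  define Cl where "Cl \<gamma> = coloured_pairs {\<gamma>}" for \<gamma>
  have finCl: "finite (Cl \<gamma>)" for \<gamma> by (simp add: Cl_def finite_coloured_pairs)
  have "coloured_pairs \<Phi> = (\<Union>\<gamma>\<in>\<Phi>. Cl \<gamma>)" by (auto simp: coloured_pairs_def Cl_def)
  then have "\<tau> * card (coloured_pairs \<Phi>) \<le> (\<Sum>\<gamma>\<in>\<Phi>. \<tau> * card (Cl \<gamma>))"
    using card_UN_le[OF assms, of Cl] by (simp flip: sum_distrib_left)
  also have "\<dots> \<le> (\<Sum>\<gamma>\<in>\<Phi>. \<tau> * (\<tau> + 2) + card (Cl \<gamma>) * (card (Cl \<gamma>) - 2))"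
  proof (rule sum_mono)
    fix \<gamma>
    show "\<tau> * card (Cl \<gamma>) \<le> \<tau> * (\<tau> + 2) + card (Cl \<gamma>) * (card (Cl \<gamma>) - 2)"
    proof (cases "card (Cl \<gamma>) \<le> \<tau> + 2")
      case True
      then show ?thesis by (meson mult_le_mono2 trans_le_add1)
    next
      case False
      then have "\<tau> \<le> card (Cl \<gamma>) - 2" by simp
      then show ?thesis by (metis mult.commute mult_le_mono2 trans_le_add2)
    qed
  qed
  also have "\<dots> = \<tau> * (\<tau> + 2) * card \<Phi> + (\<Sum>\<gamma>\<in>\<Phi>. card (Cl \<gamma>) * (card (Cl \<gamma>) - 2))"
    by (simp add: sum.distrib mult_ac)
  also have "(\<Sum>\<gamma>\<in>\<Phi>. card (Cl \<gamma>) * (card (Cl \<gamma>) - 2)) =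
      (\<Sum>\<gamma>\<in>\<Phi>. card (SIGMA p:Cl \<gamma>. Cl \<gamma> - {p, prod.swap p}))"
  proof (rule sum.cong[OF refl])
    fix \<gamma>
    have "card (SIGMA p:Cl \<gamma>. Cl \<gamma> - {p, prod.swap p}) = (\<Sum>p\<in>Cl \<gamma>. card (Cl \<gamma> - {p, prod.swap p}))"
      using finCl by (intro card_SigmaI) auto
    also have "\<dots> = (\<Sum>p\<in>Cl \<gamma>. card (Cl \<gamma>) - 2)"
    proof (rule sum.cong[OF refl])
      fix p assume p: "p \<in> Cl \<gamma>"
      then have "{p, prod.swap p} \<subseteq> Cl \<gamma>" "p \<noteq> prod.swap p"
        by (auto simp: Cl_def coloured_pairs_def insert_commute)
      then show "card (Cl \<gamma> - {p, prod.swap p}) = card (Cl \<gamma>) - 2"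
        by (simp add: card_Diff_subset)
    qed
    finally show "card (Cl \<gamma>) * (card (Cl \<gamma>) - 2) = card (SIGMA p:Cl \<gamma>. Cl \<gamma> - {p, prod.swap p})" by simp
  qed
  also have "\<dots> = card (SIGMA \<gamma>:\<Phi>. SIGMA p:Cl \<gamma>. Cl \<gamma> - {p, prod.swap p})"
    using assms finCl by (intro card_SigmaI[symmetric]) auto
  also have "\<dots> \<le> card (repeats V)"
  proof (rule card_inj_on_le)
    define F where "F = (\<lambda>(\<gamma> :: 'c, p, q). [fst p, snd p, fst q, snd q :: 'a])"
    show "inj_on F (SIGMA \<gamma>:\<Phi>. SIGMA p:Cl \<gamma>. Cl \<gamma> - {p, prod.swap p})"
      by (auto simp: F_def inj_on_def Cl_def coloured_pairs_def)
    show "F ` (SIGMA \<gamma>:\<Phi>. SIGMA p:Cl \<gamma>. Cl \<gamma> - {p, prod.swap p}) \<subseteq> repeats V"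
    proof (rule image_subsetI)
      fix t assume "t \<in> (SIGMA \<gamma>:\<Phi>. SIGMA p:Cl \<gamma>. Cl \<gamma> - {p, prod.swap p})"
      then obtain \<gamma> p q where t: "t = (\<gamma>, p, q)" "p \<in> Cl \<gamma>" "q \<in> Cl \<gamma>" "q \<noteq> p" "q \<noteq> prod.swap p"
        by blast
      obtain u v x y where pq: "p = (u, v)" "q = (x, y)" by fastforce
      have V: "u \<in> V" "v \<in> V" "x \<in> V" "y \<in> V" "u \<noteq> v" "x \<noteq> y" and col: "c {u, v} = c {x, y}"
        and n: "\<not> (x = u \<and> y = v)" "\<not> (x = v \<and> y = u)"
        using t pq by (auto simp: Cl_def coloured_pairs_def)
      have "u \<noteq> x" using proper[of u v y] V col n by auto
      moreover have "u \<noteq> y" using proper[of u v x] V col n by (auto simp: insert_commute)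
      moreover have "v \<noteq> x" using proper[of v u y] V col n by (auto simp: insert_commute)
      moreover have "v \<noteq> y" using proper[of v u x] V col n by (auto simp: insert_commute)
      ultimately show "F t \<in> repeats V"
        using V col by (simp add: t(1) pq F_def repeats_def numeral_eq_Suc)
    qed
  qed (simp add: finite_repeats)
  finally show ?thesis by simp
qed

text \<open>At most \<open>r\<close> vertices are taken and at most 2 * r are blocked by used
  colours at each of \<open>u\<close> and \<open>v\<close>, together 5 * r.\<close>

lemma link_vertex:
  assumes N: "N < card {z \<in> R - {u, v}. c {u, z} \<in> K \<and> c {v, z} \<in> K}" "5 * r \<le> N"
    and uv: "u \<in> V" "v \<in> V" and R: "R \<subseteq> V"
    and Z: "finite Z" "card Z \<le> r" and J: "finite J" "card J \<le> 2 * r"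
  obtains z where "z \<in> R" "z \<noteq> u" "z \<noteq> v" "z \<notin> Z" "c {u, z} \<in> K - c ` J" "c {v, z} \<in> K - c ` J"
proof -
  let ?A = "{z \<in> R - {u, v}. c {u, z} \<in> K \<and> c {v, z} \<in> K}"
  let ?B = "\<lambda>u. {w \<in> V - {u}. c {u, w} \<in> c ` J}"
  have B: "card (?B w) \<le> 2 * r" if "w \<in> V" for w
  proof -
    have "card (?B w) \<le> card (c ` J)" using that J by (intro card_neighbours_le) auto
    also have "\<dots> \<le> card J" by (rule card_image_le[OF J(1)])
    finally show ?thesis using J(2) by simp
  qed
  have fin: "finite (Z \<union> ?B u \<union> ?B v)" using Z finite_V by auto
  have "card (Z \<union> ?B u \<union> ?B v) \<le> card Z + card (?B u) + card (?B v)"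
    using card_Un_le[of "Z \<union> ?B u" "?B v"] card_Un_le[of Z "?B u"] by linarith
  also have "\<dots> \<le> N" using B[OF uv(1)] B[OF uv(2)] Z(2) N(2) by linarith
  finally have lt: "card (Z \<union> ?B u \<union> ?B v) < card ?A" using N(1) by simp
  have "\<not> ?A \<subseteq> Z \<union> ?B u \<union> ?B v"
  proof
    assume "?A \<subseteq> Z \<union> ?B u \<union> ?B v"
    from card_mono[OF fin this] lt show False by simp
  qed
  then obtain z where "z \<in> ?A" "z \<notin> Z \<union> ?B u \<union> ?B v" by blast
  then show thesis using that[of z] R by auto
qed

text \<open>Forest edges avoid \<open>K\<close> and link edges use only \<open>K\<close>, so the two
  kinds never clash and the links need only be rainbow among themselves. \<open>2 \<le> r\<close>
  puts the ends of the linked path on different paths of the forest, hence makes them distinct when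
  the cycle is closed.\<close>

theorem link_forest:
  assumes lf: "linear_forest r P" and FV: "forest_verts r P \<subseteq> V - R" and r: "2 \<le> r"
    and inj: "inj_on c (forest_edges r P)" and FK: "c ` forest_edges r P \<inter> K = {}"
    and R: "R \<subseteq> V" and N: "5 * r \<le> N"
    and link: "\<And>u v. u \<in> V \<Longrightarrow> v \<in> V \<Longrightarrow> u \<noteq> v \<Longrightarrow>
      N < card {z \<in> R - {u, v}. c {u, z} \<in> K \<and> c {v, z} \<in> K}"
  obtains Q Z where "distinct Q" "3 \<le> length Q" "set Q = forest_verts r P \<union> Z" "Z \<subseteq> R" "card Z \<le> r"
    "inj_on c (cycle_edges Q)"
proof -
  note lfD = linear_forestD[OF lf]
  have inV: "v \<in> V" "v \<notin> R" if "v \<in> set (P l)" "l < r" for v l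
    using that FV by (auto simp: forest_verts_def)
  \<comment> \<open>The paths up to \<open>j\<close> joined in order: \<open>Z\<close> holds the
    linking vertices, one per link, and \<open>J\<close> the linking edges, two per link.\<close>
  have "\<exists>Q Z J. distinct Q \<and> Q \<noteq> [] \<and> set Q = (\<Union>l\<le>j. set (P l)) \<union> Z \<and> Z \<subseteq> R \<and> card Z \<le> j \<and>
    hd Q = hd (P 0) \<and> last Q = last (P j) \<and> path_edges Q = (\<Union>l\<le>j. path_edges (P l)) \<union> J \<and>
    c ` J \<subseteq> K \<and> card J \<le> 2 * j \<and> finite J \<and> inj_on c J" if "j < r" for j
    using that
  proof (induction j)
    case 0
    then show ?case using lfD by (intro exI[of _ "P 0"] exI[of _ "{}"]) auto
  next
    case (Suc j)
    then obtain Q Z J where Q: "distinct Q" "Q \<noteq> []" "set Q = (\<Union>l\<le>j. set (P l)) \<union> Z" "Z \<subseteq> R"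
      "card Z \<le> j" "hd Q = hd (P 0)" "last Q = last (P j)"
      "path_edges Q = (\<Union>l\<le>j. path_edges (P l)) \<union> J"
      "c ` J \<subseteq> K" "card J \<le> 2 * j" "finite J" "inj_on c J" by fastforce
    define u v where "u = last (P j)" and "v = hd (P (Suc j))"
    have ne: "P j \<noteq> []" "P (Suc j) \<noteq> []" using lfD(1) Suc.prems by auto
    then have mem: "u \<in> set (P j)" "v \<in> set (P (Suc j))" by (auto simp: u_def v_def)
    have uv: "u \<in> V" "v \<in> V" "u \<noteq> v"
      using inV mem Suc.prems lfD(3)[of j "Suc j"] by (auto simp: disjoint_iff)
    have finZ: "finite Z" using Q(4) R finite_V by (meson finite_subset)
    obtain z where z: "z \<in> R" "z \<noteq> u" "z \<noteq> v" "z \<notin> Z"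
      "c {u, z} \<in> K - c ` J" "c {v, z} \<in> K - c ` J"
      using link_vertex[OF link[OF uv] N uv(1,2) R finZ _ Q(11)] Q(5,10) Suc.prems by auto
    have cne: "c {u, z} \<noteq> c {v, z}"
      using proper[of z u v] z uv R by (auto simp: insert_commute)
    let ?Q = "Q @ z # P (Suc j)" and ?J = "J \<union> {{u, z}, {v, z}}"
    have dj: "set Q \<inter> set (P (Suc j)) = {}"
      using Q(3,4) lfD(3)[of "Suc j"] Suc.prems inV by (fastforce simp: disjoint_iff)
    have zP: "z \<notin> set (P l)" if "l < r" for l using inV z(1) that by blast
    have zQ: "z \<notin> set Q" using Q(3) z(4) zP Suc.prems by auto
    have pe: "path_edges ?Q = (\<Union>l\<le>Suc j. path_edges (P l)) \<union> ?J"
    proof -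
      have "path_edges (z # P (Suc j)) = insert {z, v} (path_edges (P (Suc j)))"
        using path_edges_append[of "[z]" "P (Suc j)"] ne by (simp add: v_def)
      then have "path_edges ?Q = insert {u, z} (path_edges Q \<union> insert {z, v} (path_edges (P (Suc j))))"
        using path_edges_append[of Q "z # P (Suc j)"] Q(2,7) by (simp add: u_def)
      then show ?thesis unfolding Q(8) atMost_Suc by (auto simp: insert_commute)
    qed
    have "card ?J \<le> card J + card {{u, z}, {v, z}}" by (rule card_Un_le)
    also have "card {{u, z}, {v, z}} \<le> 2" by (simp add: card_insert_if)
    finally have cJ: "card ?J \<le> 2 * Suc j" using Q(10) by simp
    have iJ: "inj_on c ?J"
      unfolding Un_insert_right Un_empty_right inj_on_insert using Q(12) z(5,6) cne by blast
    show ?case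
    proof (intro exI conjI)
      show "distinct ?Q" using Q(1) dj zQ zP lfD(2) Suc.prems by auto
      show "set ?Q = (\<Union>l\<le>Suc j. set (P l)) \<union> insert z Z" using Q(3) by (auto simp: atMost_Suc)
      show "insert z Z \<subseteq> R" using Q(4) z(1) by auto
      show "card (insert z Z) \<le> Suc j" using Q(5) finZ by (simp add: card_insert_if)
      show "path_edges ?Q = (\<Union>l\<le>Suc j. path_edges (P l)) \<union> ?J" by (rule pe)
      show "c ` ?J \<subseteq> K" using Q(9) z by auto
      show "card ?J \<le> 2 * Suc j" by (rule cJ)
      show "inj_on c ?J" by (rule iJ)
    qed (use Q ne in auto)
  qed
  from this[of "r - 1"] r obtain Q Z J where Q: "distinct Q" "Q \<noteq> []"
    "set Q = (\<Union>l\<le>r - 1. set (P l)) \<union> Z" "Z \<subseteq> R"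
    "card Z \<le> r - 1" "hd Q = hd (P 0)" "last Q = last (P (r - 1))"
    "path_edges Q = (\<Union>l\<le>r - 1. path_edges (P l)) \<union> J"
    "c ` J \<subseteq> K" "card J \<le> 2 * (r - 1)" "finite J" "inj_on c J" by auto
  have at: "{..r - 1} = {..<r}" using r by auto
  define u v where "u = last Q" and "v = hd Q"
  have mem: "u \<in> set (P (r - 1))" "v \<in> set (P 0)"
    using lfD(1)[of "r - 1"] lfD(1)[of 0] r Q(6,7) by (auto simp: u_def v_def)
  have uv: "u \<in> V" "v \<in> V" "u \<noteq> v"
    using inV mem r lfD(3)[of 0 "r - 1"] by (auto simp: disjoint_iff)
  have finZ: "finite Z" using Q(4) R finite_V by (meson finite_subset)
  have cZJ: "card Z \<le> r" "card J \<le> 2 * r" using Q(5,10) by simp_all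
  obtain z where z: "z \<in> R" "z \<noteq> u" "z \<noteq> v" "z \<notin> Z"
    "c {u, z} \<in> K - c ` J" "c {v, z} \<in> K - c ` J"
    using link_vertex[OF link[OF uv] N uv(1,2) R finZ cZJ(1) Q(11) cZJ(2)] by blast
  have cne: "c {u, z} \<noteq> c {v, z}" using proper[of z u v] z uv R by (auto simp: insert_commute)
  have zQ: "z \<notin> set Q" using Q(3) z(1,4) inV r by fastforce
  have ce: "cycle_edges (Q @ [z]) = insert {u, z} (insert {v, z} (forest_edges r P \<union> J))"
    using cycle_edges_append[of Q "[z]"] Q(2,8) unfolding at
    by (auto simp: u_def v_def forest_edges_def insert_commute)
  have "c {u, z} \<notin> c ` (forest_edges r P \<union> J)" "c {v, z} \<notin> c ` (forest_edges r P \<union> J)"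
    using z(5,6) FK by blast+
  moreover have "inj_on c (forest_edges r P \<union> J)"
    using inj Q(12) FK Q(9) by (auto simp: inj_on_Un)
  ultimately have "inj_on c (cycle_edges (Q @ [z]))"
    unfolding ce inj_on_insert using cne by blast
  moreover have "set (Q @ [z]) = forest_verts r P \<union> insert z Z"
    using Q(3) unfolding at by (auto simp: forest_verts_def)
  moreover have "3 \<le> length (Q @ [z])"
  proof -
    have "card {u, v} \<le> card (set Q)" using Q(2) by (intro card_mono) (auto simp: u_def v_def)
    then show ?thesis using uv(3) Q(1) by (simp add: distinct_card)
  qed
  moreover have "card (insert z Z) \<le> r" using Q(5) r by (intro card_insert_le_m1) auto
  moreover have "distinct (Q @ [z])" using Q(1) zQ by simp
  ultimately show thesis using that[of "Q @ [z]" "insert z Z"] Q(4) z(1) by blast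
qed

end

subsection \<open>Two disjoint rainbow cycles\<close>

context proper_colouring
begin

theorem two_rainbow_cycles:
  assumes n: "1000000000000 * s \<le> card V" "card V < 1000000000000 * s + 1000000000000"
    and s: "4000000000000 \<le> s"
    and \<eta>: "0 \<le> \<eta>" "\<eta> \<le> 1"
    and N: "5 * 4000000000000 \<le> N"
    and small: "real (card V)^2 * (2^N * (1 - \<eta> * \<eta> / 2)^s) +
      card V * ((1 + \<eta>)^card V / 2^(s div 2)) < 1"
  obtains Q1 Q2 where "distinct Q1" "distinct Q2" "3 \<le> length Q1" "3 \<le> length Q2"
    "set Q1 \<inter> set Q2 = {}" "set Q1 \<union> set Q2 = V"
    "inj_on c (cycle_edges Q1)" "inj_on c (cycle_edges Q2)"
proof -
  define r where "r = (4000000000000 :: nat)"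
  define T where "T = s div 2"
  have "9010 * s \<le> card V" using n by linarith
  from sparse_subset[OF this] obtain R where R: "R \<subseteq> V" "card R = 9010 * s"
    "card (repeats R) * card V ^ 4 \<le> card (repeats V) * (9010 * s) ^ 4" by blast
  have finR: "finite R" using R(1) finite_V by (rule finite_subset)
  \<comment> \<open>9010^4 / 10^12 is just below 6591.\<close>
  have repR: "card (repeats R) \<le> 6591 * s ^ 3"
  proof -
    have V0: "0 < card V" using n s by linarith
    have "card V ^ 3 * (card (repeats R) * card V) = card (repeats R) * card V ^ 4"
      by (simp add: power4_eq_xxxx power3_eq_cube mult_ac)
    also have "\<dots> \<le> card V ^ 3 * (9010 * s) ^ 4"
      using R(3) card_repeats_le mult_le_mono1 order.trans by blast
    finally have "card (repeats R) * card V \<le> (9010 * s) ^ 4" using V0 by simp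
    moreover have "card (repeats R) * (1000000000000 * s) \<le> card (repeats R) * card V"
      using n(1) by (rule mult_le_mono2)
    ultimately have "card (repeats R) * (1000000000000 * s) \<le> (9010 * s) ^ 4" by linarith
    also have "\<dots> = (6590208636010000 * s ^ 3) * s"
      by (simp add: power_mult_distrib power4_eq_xxxx power3_eq_cube)
    finally have "(card (repeats R) * 1000000000000) * s \<le> (6590208636010000 * s ^ 3) * s"
      by (simp only: mult_ac)
    then have "card (repeats R) * 1000000000000 \<le> 6590208636010000 * s ^ 3" using s by simp
    then show ?thesis by linarith
  qed
  have "3 * s + 2 \<le> card R" using R(2) s by linarith
  from reserved_colours[OF R(1) this \<eta> small]
  obtain K where K: "\<And>v. v \<in> V \<Longrightarrow> card {w \<in> V - {v}. c {v, w} \<in> K} \<le> T"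
    "\<And>u v. u \<in> V \<Longrightarrow> v \<in> V \<Longrightarrow> u \<noteq> v \<Longrightarrow>
      N < card {z \<in> R - {u, v}. c {u, z} \<in> K \<and> c {v, z} \<in> K}" unfolding T_def by blast
  interpret V': proper_colouring "V - R" c by (rule proper_subset) auto
  have cV': "card (V - R) = card V - 9010 * s" using R finR by (simp add: card_Diff_subset)
  have degV': "card {w \<in> V - R - {v}. c {v, w} \<in> K} \<le> T" if "v \<in> V - R" for v
  proof -
    have "card {w \<in> V - R - {v}. c {v, w} \<in> K} \<le> card {w \<in> V - {v}. c {v, w} \<in> K}"
      using finite_V by (intro card_mono) auto
    then show ?thesis using K(1)[of v] that by auto
  qed
  have "0 < r" "r \<le> card (V - R)" using n s by (simp_all add: cV' r_def)
  from V'.rainbow_forest[OF degV' this] obtain P where P: "linear_forest r P"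
    "forest_verts r P \<subseteq> V - R" "inj_on c (forest_edges r P)" "c ` forest_edges r P \<inter> K = {}"
    "r * card (V - R - forest_verts r P) \<le> r * T + card (V - R)" by blast
  have "2 \<le> r" "5 * r \<le> N" using N by (simp_all add: r_def)
  from link_forest[OF P(1,2) this(1) P(3,4) R(1) this(2) K(2)] obtain Q1 Z where Q1:
    "distinct Q1" "3 \<le> length Q1" "set Q1 = forest_verts r P \<union> Z" "Z \<subseteq> R" "card Z \<le> r"
    "inj_on c (cycle_edges Q1)" by blast
  define X where "X = V - R - forest_verts r P"
  define L where "L = (R - Z) \<union> X"
  have L: "L = V - set Q1" using R(1) P(2) Q1(3,4) by (auto simp: L_def X_def)
  have finX: "finite X" using finite_V by (simp add: X_def)
  have finL: "finite L" using finR finX by (simp add: L_def)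
  \<comment> \<open>The bound of the rotation argument is s/2 from the reserved colours plus about
    s/4 from card V / r.\<close>
  have cX: "card X \<le> s"
  proof -
    have "4000000000000 * card X \<le> 4000000000000 * T + card V"
      using P(5) cV' by (simp add: X_def r_def)
    moreover have "2 * T \<le> s" by (simp add: T_def)
    ultimately show ?thesis using n(2) s by linarith
  qed
  have "card Z + card (R - Z) = card R"
    using Q1(4) finR by (metis add.commute card_Diff_subset card_mono finite_subset le_add_diff_inverse2)
  moreover have "card (R - Z) \<le> card L" using finL by (intro card_mono) (auto simp: L_def)
  ultimately have cL1: "900 * (10 * s) \<le> card L" using Q1(5) R(2) s unfolding r_def by linarith
  have "card L \<le> card (R - Z) + card X" unfolding L_def by (rule card_Un_le)
  moreover have "card (R - Z) \<le> card R" using finR by (intro card_mono) auto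
  ultimately have cL2: "card L \<le> 9011 * s" using cX R(2) by linarith
  interpret R: proper_colouring R c by (rule proper_subset[OF R(1)])
  interpret L: proper_colouring L c by (rule proper_subset) (auto simp: L)
  have "\<exists>Q. distinct Q \<and> set Q = L \<and> inj_on c (cycle_edges Q)"
  proof (rule L.rainbow_hamilton_cycle[of "10 * s"])
    show "100 \<le> 10 * s" using s by simp
    show "900 * (10 * s) \<le> card L" by (rule cL1)
    fix \<Psi> :: "'c set" assume \<Psi>: "finite \<Psi>" "card \<Psi> \<le> card L"
    \<comment> \<open>The threshold \<tau> = s makes both terms of order s * s after division by
      \<open>s\<close>.\<close>
    have "s * card (R.coloured_pairs \<Psi>) \<le> s * (s + 2) * card \<Psi> + card (repeats R)"
      by (rule R.coloured_pairs_le[OF \<Psi>(1)])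
    also have "\<dots> \<le> s * (s + 2) * (9011 * s) + 6591 * s ^ 3"
      using \<Psi>(2) cL2 repR by (intro add_mono mult_le_mono2) auto
    also have "\<dots> = s * (15602 * s * s + 18022 * s)"
      by (simp add: power3_eq_cube algebra_simps)
    finally have 1: "card (R.coloured_pairs \<Psi>) \<le> 15602 * s * s + 18022 * s" using s by simp
    \<comment> \<open>Pairs not inside \<open>R\<close> have an entry in \<open>X\<close>; they add
      at most 2 * 9011 * s * s, which keeps the total below 41000 * s * s = 410 * (10 * s) * (10 *
      s).\<close>
    have "L.coloured_pairs \<Psi> \<subseteq> R.coloured_pairs \<Psi> \<union> X \<times> L \<union> L \<times> X"
      unfolding L.coloured_pairs_def R.coloured_pairs_def by (auto simp: L_def)
    then have "card (L.coloured_pairs \<Psi>) \<le> card (R.coloured_pairs \<Psi> \<union> X \<times> L \<union> L \<times> X)"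
      using finX finL R.finite_coloured_pairs by (intro card_mono) auto
    also have "\<dots> \<le> card (R.coloured_pairs \<Psi>) + card (X \<times> L) + card (L \<times> X)"
      using card_Un_le[of "R.coloured_pairs \<Psi> \<union> X \<times> L" "L \<times> X"]
        card_Un_le[of "R.coloured_pairs \<Psi>" "X \<times> L"] by linarith
    also have "\<dots> \<le> (15602 * s * s + 18022 * s) + s * (9011 * s) + (9011 * s) * s"
      unfolding card_cartesian_product by (intro add_mono 1 mult_le_mono cX cL2)
    also have "\<dots> = 33624 * (s * s) + 18022 * s" by (simp add: algebra_simps)
    also have "\<dots> \<le> 33624 * (s * s) + s * s" using s by (intro add_left_mono mult_le_mono1) simp
    also have "\<dots> \<le> 410 * (10 * s) * (10 * s)" by simp
    finally show "card (L.coloured_pairs \<Psi>) \<le> 410 * (10 * s) * (10 * s)" .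
  qed
  then obtain Q2 where Q2: "distinct Q2" "set Q2 = L" "inj_on c (cycle_edges Q2)" by blast
  have "3 \<le> length Q2" using Q2 cL1 s distinct_card[of Q2] by simp
  moreover have "set Q1 \<subseteq> V" using Q1(3,4) P(2) R(1) by auto
  then have "set Q1 \<union> set Q2 = V" "set Q1 \<inter> set Q2 = {}" using Q2(2) L by auto
  ultimately show thesis using that[of Q1 Q2] Q1(1,2,6) Q2(1,3) by blast
qed

end

section \<open>Asymptotics of the bound used for reserving colours\<close>

lemma eventually_few_failures:
  fixes C :: real
  shows "eventually (\<lambda>n. let s = n div 1000000000000 in
    real n^2 * (C * (1 - (1 / 10^13) * (1 / 10^13) / 2)^s) +
      real n * ((1 + 1 / 10^13)^n / 2^(s div 2)) < 1) at_top"
proof -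
  define \<eta> :: real where "\<eta> = 1 / 10^13"
  define q :: real where "q = 1000000000000"
  have q: "0 < q" and \<eta>: "0 < \<eta>" "\<eta> < 1" "4 * q * \<eta> < 1" by (simp_all add: q_def \<eta>_def)
  \<comment> \<open>The exponential decay rates of the two terms. The second is positive because (1
    + \<eta>)^n grows at rate at most \<eta>, below the rate 1/(4q) guaranteed for 2^(s div
    2).\<close>
  define a1 a2 where "a1 = \<eta> * \<eta> / (2 * q)" and "a2 = 1 / (4 * q) - \<eta>"
  have a: "0 < a1" "0 < a2" using q \<eta> by (simp_all add: a1_def a2_def field_simps)
  define B where "B n = real n^2 * (\<bar>C\<bar> * exp (\<eta> * \<eta> / 2) * exp (- a1 * real n)) +
    real n * (exp (1 / 2) * exp (- a2 * real n))" for n :: nat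
  have "((\<lambda>n. real n^2 * (\<bar>C\<bar> * exp (\<eta> * \<eta> / 2) * exp (- a1 * real n))) \<longlongrightarrow> 0) at_top"
    using a(1) by real_asymp
  moreover have "((\<lambda>n. real n * (exp (1 / 2) * exp (- a2 * real n))) \<longlongrightarrow> 0) at_top"
    using a(2) by real_asymp
  ultimately have "(B \<longlongrightarrow> 0 + 0) at_top" unfolding B_def by (intro tendsto_add)
  then have "eventually (\<lambda>n. B n < 1) at_top" by (intro order_tendstoD(2)) auto
  then show ?thesis
  proof (rule eventually_mono)
    fix n :: nat assume B1: "B n < 1"
    define s where "s = n div 1000000000000"
    have sn: "real n / q - 1 \<le> real s"
    proof -
      have "n < 1000000000000 * s + 1000000000000"
        using div_mult_mod_eq[of n 1000000000000] mod_less_divisor[of 1000000000000 n]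
        unfolding s_def by linarith
      then have "real n < q * real s + q" unfolding q_def by linarith
      then show ?thesis using q by (simp add: field_simps)
    qed
    have x: "0 \<le> 1 - \<eta> * \<eta> / 2" using \<eta> mult_le_one[of \<eta> \<eta>] by simp
    have "(1 - \<eta> * \<eta> / 2)^s \<le> exp (- (\<eta> * \<eta> / 2))^s"
      using x exp_ge_add_one_self[of "- (\<eta> * \<eta> / 2)"] by (intro power_mono) auto
    also have "\<dots> = exp (- (\<eta> * \<eta> / 2) * real s)" by (simp add: exp_of_nat_mult[symmetric] mult.commute)
    also have "\<dots> \<le> exp (\<eta> * \<eta> / 2 + - a1 * real n)"
    proof -
      define k where "k = \<eta> * \<eta> / 2"
      have "k * (real n / q - 1) \<le> k * real s" unfolding k_def using sn \<eta> by (intro mult_left_mono) auto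
      moreover have "a1 * real n = k * (real n / q)" by (simp add: a1_def k_def)
      ultimately show ?thesis by (simp add: right_diff_distrib flip: k_def)
    qed
    finally have 1: "(1 - \<eta> * \<eta> / 2)^s \<le> exp (\<eta> * \<eta> / 2) * exp (- a1 * real n)"
      unfolding exp_add .
    have "C * (1 - \<eta> * \<eta> / 2)^s \<le> \<bar>C\<bar> * (1 - \<eta> * \<eta> / 2)^s" using x by (intro mult_right_mono) auto
    also have "\<dots> \<le> \<bar>C\<bar> * (exp (\<eta> * \<eta> / 2) * exp (- a1 * real n))" using 1 by (intro mult_left_mono) auto
    finally have 2: "real n^2 * (C * (1 - \<eta> * \<eta> / 2)^s) \<le>
        real n^2 * (\<bar>C\<bar> * exp (\<eta> * \<eta> / 2) * exp (- a1 * real n))"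
      by (intro mult_left_mono) (auto simp: mult.assoc)
    have "(1 + \<eta>)^n \<le> exp \<eta>^n" using \<eta> exp_ge_add_one_self[of \<eta>] by (intro power_mono) auto
    also have "\<dots> = exp (\<eta> * real n)" by (simp add: exp_of_nat_mult[symmetric] mult.commute)
    finally have 3: "(1 + \<eta>)^n \<le> exp (\<eta> * real n)" .
    \<comment> \<open>From exp (1/2) \<le> 2, s div 2 \<ge> (s - 1)/2 and s \<ge> n/q - 1; the two
      roundings together cost the 1/2 in the exponent.\<close>
    have 4: "exp (real n / (4 * q) - 1 / 2) \<le> 2^(s div 2)"
    proof -
      have e: "exp (1 / 2) \<le> (2::real)"
      proof -
        have "exp (1 / 2) ^ 2 = exp (1::real)" by (simp add: power2_eq_square exp_add[symmetric])
        also have "\<dots> \<le> 2 ^ 2" using exp_le by simp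
        finally show ?thesis by (rule power2_le_imp_le) simp
      qed
      have "real s - 1 \<le> 2 * real (s div 2)" by linarith
      then have "real n / (4 * q) - 1 / 2 \<le> 1 / 2 * real (s div 2)" using sn by simp
      then have "exp (real n / (4 * q) - 1 / 2) \<le> exp (1 / 2 * real (s div 2))" by simp
      also have "\<dots> = exp (1 / 2) ^ (s div 2)" by (simp only: exp_of_nat_mult[symmetric] mult.commute)
      also have "\<dots> \<le> 2 ^ (s div 2)" using e by (intro power_mono) auto
      finally show ?thesis .
    qed
    have "(1 + \<eta>)^n / 2^(s div 2) \<le> exp (\<eta> * real n) / exp (real n / (4 * q) - 1 / 2)"
      using 3 4 \<eta> by (intro frac_le) auto
    also have "\<dots> = exp (1 / 2) * exp (- a2 * real n)"
      by (simp add: exp_diff[symmetric] exp_add[symmetric] a2_def algebra_simps)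
    finally have 5: "real n * ((1 + \<eta>)^n / 2^(s div 2)) \<le>
        real n * (exp (1 / 2) * exp (- a2 * real n))" by (intro mult_left_mono) auto
    have "real n^2 * (C * (1 - \<eta> * \<eta> / 2)^s) + real n * ((1 + \<eta>)^n / 2^(s div 2)) \<le> B n"
      unfolding B_def by (rule add_mono[OF 2 5])
    with B1 show "let s = n div 1000000000000 in
      real n^2 * (C * (1 - (1 / 10^13) * (1 / 10^13) / 2)^s) +
      real n * ((1 + 1 / 10^13)^n / 2^(s div 2)) < 1"
      unfolding Let_def s_def[symmetric] \<eta>_def[symmetric] by linarith
  qed
qed

section \<open>Translation to the complete graph\<close>

lemma cycle_in_complete_graph:
  assumes "distinct Q" "3 \<le> length Q" "set Q \<subseteq> {..<n}"
  shows "is_cycle (set Q, cycle_edges Q)" "subgraph (set Q, cycle_edges Q) (complete_graph n)"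
proof -
  have ne: "Q \<noteq> []" using assms by auto
  have ce: "cycle_edges Q = {{Q ! i, Q ! (Suc i mod length Q)} |i. i < length Q}"
    unfolding cycle_edges_nth[OF ne] by auto
  show "is_cycle (set Q, cycle_edges Q)"
    unfolding is_cycle_def using assms ce by (intro exI[of _ Q]) simp
  have "{Q ! i, Q ! (Suc i mod length Q)} \<in> edges (complete_graph n)" if "i < length Q" for i
  proof -
    have l: "Suc i mod length Q < length Q" using assms by (intro mod_less_divisor) auto
    have "i \<noteq> Suc i mod length Q" using that assms(2) by (auto simp: mod_Suc)
    then have "Q ! i \<noteq> Q ! (Suc i mod length Q)"
      using assms(1) that l by (simp add: nth_eq_iff_index_eq)
    moreover have "Q ! i < n" "Q ! (Suc i mod length Q) < n"
      using assms(3) nth_mem[OF that] nth_mem[OF l] by auto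
    ultimately show ?thesis by (auto simp: complete_graph_def)
  qed
  then show "subgraph (set Q, cycle_edges Q) (complete_graph n)"
    unfolding subgraph_def ce using assms(3) by (auto simp: complete_graph_def)
qed

lemma proper_colouring_complete_graph:
  assumes "proper_edge_colouring (complete_graph n) c"
  shows "proper_colouring {..<n} c"
proof
  fix u v w
  assume V: "u \<in> {..<n}" "v \<in> {..<n}" "w \<in> {..<n}" "u \<noteq> v" "u \<noteq> w" and eq: "c {u, v} = c {u, w}"
  have "{u, v} \<in> edges (complete_graph n)" "{u, w} \<in> edges (complete_graph n)"
    using V by (auto simp: complete_graph_def)
  then have "{u, v} = {u, w}"
    using assms[unfolded proper_edge_colouring_def, rule_format, of "{u, v}" "{u, w}"] eq by auto
  then show "v = w" using V(4,5) by (auto simp: doubleton_eq_iff)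
qed simp

theorem theorem1p1:
  "\<exists>n\<^sub>0 :: nat. \<forall>n \<ge> n\<^sub>0. \<forall>c :: nat set \<Rightarrow> nat.
     proper_edge_colouring (complete_graph n) c \<longrightarrow>
     (\<exists>C\<^sub>1 C\<^sub>2.
        subgraph C\<^sub>1 (complete_graph n) \<and> subgraph C\<^sub>2 (complete_graph n) \<and>
        is_cycle C\<^sub>1 \<and> is_cycle C\<^sub>2 \<and>
        rainbow c C\<^sub>1 \<and> rainbow c C\<^sub>2 \<and>
        verts C\<^sub>1 \<inter> verts C\<^sub>2 = {} \<and>
        verts C\<^sub>1 \<union> verts C\<^sub>2 = verts (complete_graph n))"
proof -
  define N :: nat where "N = 5 * 4000000000000"
  obtain n1 where n1: "\<And>n. n \<ge> n1 \<Longrightarrow> let s = n div 1000000000000 in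
    real n^2 * (2^N * (1 - (1 / 10^13) * (1 / 10^13) / 2)^s) +
      real n * ((1 + 1 / 10^13)^n / 2^(s div 2)) < 1"
    using eventually_few_failures[of "2^N"] unfolding eventually_at_top_linorder by blast
  show ?thesis
  \<comment> \<open>4*10^24 is 10^12 times the lower bound 4*10^12 required of
    \<open>s\<close>.\<close>
  proof (intro exI[of _ "max n1 4000000000000000000000000"] allI impI)
    fix n :: nat and c :: "nat set \<Rightarrow> nat"
    assume n: "max n1 4000000000000000000000000 \<le> n"
      and c: "proper_edge_colouring (complete_graph n) c"
    interpret proper_colouring "{..<n}" c by (rule proper_colouring_complete_graph[OF c])
    define s where "s = n div 1000000000000"
    have "4000000000000000000000000 \<le> n" using n by simp
    then have s4: "4000000000000 \<le> s"
      unfolding s_def using div_le_mono[of 4000000000000000000000000 n 1000000000000] by simp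
    have s: "1000000000000 * s \<le> card {..<n}" "card {..<n} < 1000000000000 * s + 1000000000000"
      using div_mult_mod_eq[of n 1000000000000] mod_less_divisor[of 1000000000000 n]
      unfolding s_def by simp_all
    have "real n^2 * (2^N * (1 - (1 / 10^13) * (1 / 10^13) / 2)^s) +
      real n * ((1 + 1 / 10^13)^n / 2^(s div 2)) < 1"
      using n1[of n] n unfolding Let_def s_def by simp
    then have small: "real (card {..<n})^2 * (2^N * (1 - (1 / 10^13) * (1 / 10^13) / 2)^s) +
      real (card {..<n}) * ((1 + 1 / 10^13)^card {..<n} / 2^(s div 2)) < 1"
      unfolding card_lessThan .
    have "5 * 4000000000000 \<le> N" "0 \<le> (1 / 10^13 :: real)" "(1 / 10^13 :: real) \<le> 1"
      by (simp_all add: N_def)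
    from two_rainbow_cycles[OF s s4 this(2,3,1) small]
    obtain Q1 Q2 where Q: "distinct Q1" "distinct Q2" "3 \<le> length Q1" "3 \<le> length Q2"
      "set Q1 \<inter> set Q2 = {}" "set Q1 \<union> set Q2 = {..<n}"
      "inj_on c (cycle_edges Q1)" "inj_on c (cycle_edges Q2)" by blast
    have "set Q1 \<subseteq> {..<n}" "set Q2 \<subseteq> {..<n}" using Q(6) by auto
    note G = cycle_in_complete_graph[OF Q(1,3) this(1)] cycle_in_complete_graph[OF Q(2,4) this(2)]
    show "\<exists>C\<^sub>1 C\<^sub>2.
        subgraph C\<^sub>1 (complete_graph n) \<and> subgraph C\<^sub>2 (complete_graph n) \<and>
        is_cycle C\<^sub>1 \<and> is_cycle C\<^sub>2 \<and>
        rainbow c C\<^sub>1 \<and> rainbow c C\<^sub>2 \<and>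
        verts C\<^sub>1 \<inter> verts C\<^sub>2 = {} \<and>
        verts C\<^sub>1 \<union> verts C\<^sub>2 = verts (complete_graph n)"
      using G Q(5-8)
      by (intro exI[of _ "(set Q1, cycle_edges Q1)"] exI[of _ "(set Q2, cycle_edges Q2)"])
        (simp add: rainbow_def complete_graph_def)
  qed
qed

end
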